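(* Let $n\ge 1$, let $t_1,\dots,t_n$ and $s_1,\dots,s_n$ be rational tangles of type 2 (i.e. negative rational tangles), and let $L=L\left((t_1,s_1),\dots,(t_n,s_n),h^{l}\right)$. (i) If $l=3$ and $|s_n|\ge 1$, then $IQ(L)$ is not left-orderable. (ii) If $l=-3$ and $|t_1|\le 1$, then $IQ(L)$ is not left-orderable.
   Context: **Quandles.** A quandle is a set $Q$ with a binary operation $*$ such that $x*x=x$; for all $x,y$ there is a unique $z$ with $z*y=x$; and $(x*y)*z=(x*z)*(y*z)$. It is involutory if $(x*y)*y=x$ for all $x,y$. A left-order on $Q$ is a strict linear order $<$ such that $x<y$ implies $z*x<z*y$ for all $x,y,z\in Q$. $Q$ is left-orderable if it has a left-order; by convention a trivial quandle (one with $x*y=x$ for all $x,y$), in particular the one-element quandle, is not considered left-orderable. For a diagram $D$ of a link $L$, the involutory quandle $IQ(L)$ is the involutory quandle generated by the arcs of $D$ with, for each crossing with over-arc $y$ and under-arcs $x,z$, the relation $z=x*y$. It is an invariant of the unoriented link $L$. **Rational tangles.** Tangle diagrams lie in a disk with four boundary endpoints $NW,NE,SW,SE$. A type 2 (negative) rational tangle is identified with its fraction, a negative rational number $[a_1,\dots,a_m]=a_1+\frac{1}{a_2+\frac{1}{\ddots+\frac{1}{a_m}}}$ with $m$ odd, $a_1\le 0$ and $a_i<0$ for $i\ge 2$ (and $a_1<0$ if $m=1$). Its standard diagram is obtained as follows: start with a horizontal row of $|a_m|$ crossings, attach below it a vertical column of $|a_{m-1}|$ crossings, attach to the right a horizontal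 row of $|a_{m-2}|$ crossings, and so on, ending with a row of $|a_1|$ crossings on the right; each crossing has its over-strand running from upper left to lower right (so that the diagram is alternating). For instance $-q$ is a horizontal row of $q$ such crossings and $-\frac1p$ is a vertical column of $p$ such crossings. $|t|$ denotes the absolute value of the fraction of $t$. **The link.** Draw 3-braids horizontally from left to right, with strand positions $1,2,3$ from top to bottom. The generator $\sigma_i$ ($i=1,2$) is the crossing of the strands at positions $i,i+1$ whose over-strand runs from lower left to upper right. Put $h=\sigma_1\sigma_2$, so that $h^{3}$ is the full twist. The link $L((t_1,s_1),\dots,(t_n,s_n),h^l)$ is the closure (in the manner of a braid closure) of the three-strand diagram which reads from left to right: $h^l$, then $t_1,s_1,t_2,s_2,\dots,t_n,s_n$, where each $s_i$ is the standard diagram inserted on the strand positions $2,3$ without rotation, and each $t_i$ is the standard diagram rotated by $90^\circ$ in the plane (without changing crossings) and inserted on the strand positions $1,2$. Thus for positive integers $p_i,q_i$ the link $L\left((-\frac1{p_1},-q_1),\dots,(-\frac1{p_n},-q_n),h^l\right)$ is the closure of the 3-braid $\sigma_1^{p_1}\sigma_2^{-q_1}\cdots\sigma_1^{p_n}\sigma_2^{-q_n}h^l$. *)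

theory Defs
  imports Complex_Main
begin

section \<open>Quandles and left-orders\<close>

locale quandle =
  fixes Q :: "'a set" and star :: "'a \<Rightarrow> 'a \<Rightarrow> 'a"
  assumes closed: "\<lbrakk>x \<in> Q; y \<in> Q\<rbrakk> \<Longrightarrow> star x y \<in> Q"
    and idem: "x \<in> Q \<Longrightarrow> star x x = x"
    and right_div: "\<lbrakk>x \<in> Q; y \<in> Q\<rbrakk> \<Longrightarrow> \<exists>!z. z \<in> Q \<and> star z y = x"
    and right_dist: "\<lbrakk>x \<in> Q; y \<in> Q; z \<in> Q\<rbrakk> \<Longrightarrow>
      star (star x y) z = star (star x z) (star y z)"

locale involutory_quandle = quandle +
  assumes invol: "\<lbrakk>x \<in> Q; y \<in> Q\<rbrakk> \<Longrightarrow> star (star x y) y = x"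

definition trivial_quandle :: "'a set \<Rightarrow> ('a \<Rightarrow> 'a \<Rightarrow> 'a) \<Rightarrow> bool" where
  "trivial_quandle Q star \<longleftrightarrow> (\<forall>x\<in>Q. \<forall>y\<in>Q. star x y = x)"

definition left_order :: "'a set \<Rightarrow> ('a \<Rightarrow> 'a \<Rightarrow> 'a) \<Rightarrow> ('a \<Rightarrow> 'a \<Rightarrow> bool) \<Rightarrow> bool" where
  "left_order Q star lt \<longleftrightarrow>
     (\<forall>x\<in>Q. \<not> lt x x) \<and>
     (\<forall>x\<in>Q. \<forall>y\<in>Q. \<forall>z\<in>Q. lt x y \<longrightarrow> lt y z \<longrightarrow> lt x z) \<and>
     (\<forall>x\<in>Q. \<forall>y\<in>Q. x \<noteq> y \<longrightarrow> lt x y \<or> lt y x) \<and>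
     (\<forall>x\<in>Q. \<forall>y\<in>Q. \<forall>z\<in>Q. lt x y \<longrightarrow> lt (star z x) (star z y))"

text \<open>The relation \<open>lt\<close> only matters on \<open>Q\<close>. Trivial quandles are excluded by convention;
  this only affects quandles with at most one element.\<close>

definition left_orderable :: "'a set \<Rightarrow> ('a \<Rightarrow> 'a \<Rightarrow> 'a) \<Rightarrow> bool" where
  "left_orderable Q star \<longleftrightarrow> \<not> trivial_quandle Q star \<and> (\<exists>lt. left_order Q star lt)"


section \<open>Involutory quandles given by generators and relations\<close>

datatype 'g qterm = Gen 'g | Op "'g qterm" "'g qterm"

definition qterms :: "'g set \<Rightarrow> 'g qterm set" where
  "qterms A = {t. set_qterm t \<subseteq> A}"

inductive iq_eq :: "'g set \<Rightarrow> ('g qterm \<times> 'g qterm) set \<Rightarrow> 'g qterm \<Rightarrow> 'g qterm \<Rightarrow> bool"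
  for A :: "'g set" and R :: "('g qterm \<times> 'g qterm) set" where
  rel: "\<lbrakk>(s, t) \<in> R; s \<in> qterms A; t \<in> qterms A\<rbrakk> \<Longrightarrow> iq_eq A R s t"
| idem: "x \<in> qterms A \<Longrightarrow> iq_eq A R (Op x x) x"
| invol: "\<lbrakk>x \<in> qterms A; y \<in> qterms A\<rbrakk> \<Longrightarrow> iq_eq A R (Op (Op x y) y) x"
| dist: "\<lbrakk>x \<in> qterms A; y \<in> qterms A; z \<in> qterms A\<rbrakk> \<Longrightarrow>
    iq_eq A R (Op (Op x y) z) (Op (Op x z) (Op y z))"
| cong: "\<lbrakk>iq_eq A R x x'; iq_eq A R y y'\<rbrakk> \<Longrightarrow> iq_eq A R (Op x y) (Op x' y')"
| refl: "x \<in> qterms A \<Longrightarrow> iq_eq A R x x"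
| sym: "iq_eq A R x y \<Longrightarrow> iq_eq A R y x"
| trans: "\<lbrakk>iq_eq A R x y; iq_eq A R y z\<rbrakk> \<Longrightarrow> iq_eq A R x z"

definition iq_rel :: "'g set \<Rightarrow> ('g qterm \<times> 'g qterm) set \<Rightarrow> ('g qterm \<times> 'g qterm) set" where
  "iq_rel A R = {(s, t). iq_eq A R s t}"

definition iq_carrier :: "'g set \<Rightarrow> ('g qterm \<times> 'g qterm) set \<Rightarrow> 'g qterm set set" where
  "iq_carrier A R = qterms A // iq_rel A R"

definition iq_star :: "'g set \<Rightarrow> ('g qterm \<times> 'g qterm) set \<Rightarrow>
    'g qterm set \<Rightarrow> 'g qterm set \<Rightarrow> 'g qterm set" where
  "iq_star A R X Y = (\<Union>x\<in>X. \<Union>y\<in>Y. iq_rel A R `` {Op x y})"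

lemma qterms_simps [simp]:
  "Gen g \<in> qterms A \<longleftrightarrow> g \<in> A"
  "Op s t \<in> qterms A \<longleftrightarrow> s \<in> qterms A \<and> t \<in> qterms A"
  by (auto simp: qterms_def)

lemma iq_eq_qterms: "iq_eq A R s t \<Longrightarrow> s \<in> qterms A \<and> t \<in> qterms A"
  by (induction rule: iq_eq.induct) auto

lemma equiv_iq_rel: "equiv (qterms A) (iq_rel A R)"
  by (rule equivI)
    (auto simp: iq_rel_def refl_on_def sym_def trans_def dest: iq_eq_qterms
      intro: iq_eq.refl iq_eq.sym iq_eq.trans)

lemma iq_star_class:
  assumes "x \<in> qterms A" "y \<in> qterms A"
  shows "iq_star A R (iq_rel A R `` {x}) (iq_rel A R `` {y}) = iq_rel A R `` {Op x y}"
proof -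
  have "congruent2 (iq_rel A R) (iq_rel A R) (\<lambda>x y. iq_rel A R `` {Op x y})"
  proof (rule congruent2I'[OF equiv_class_eq[OF equiv_iq_rel]])
    fix x x' y y' assume "(x, x') \<in> iq_rel A R" "(y, y') \<in> iq_rel A R"
    then show "(Op x y, Op x' y') \<in> iq_rel A R"
      by (simp add: iq_rel_def iq_eq.cong)
  qed
  then show ?thesis
    unfolding iq_star_def using UN_equiv_class2[OF equiv_iq_rel equiv_iq_rel] assms by blast
qed

lemma iq_class_eq: "iq_eq A R s t \<Longrightarrow> iq_rel A R `` {s} = iq_rel A R `` {t}"
  by (rule equiv_class_eq[OF equiv_iq_rel]) (simp add: iq_rel_def)

lemma iq_carrierE:
  assumes "X \<in> iq_carrier A R"
  obtains x where "x \<in> qterms A" "X = iq_rel A R `` {x}"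
  using assms unfolding iq_carrier_def by (rule quotientE)

lemma iq_carrierI: "x \<in> qterms A \<Longrightarrow> iq_rel A R `` {x} \<in> iq_carrier A R"
  unfolding iq_carrier_def by (rule quotientI)

theorem involutory_quandle_iq: "involutory_quandle (iq_carrier A R) (iq_star A R)"
proof -
  let ?Q = "iq_carrier A R" and ?s = "iq_star A R"
  have closed: "?s X Y \<in> ?Q" if "X \<in> ?Q" "Y \<in> ?Q" for X Y
    using that by (elim iq_carrierE) (simp add: iq_star_class iq_carrierI)
  have idem: "?s X X = X" if "X \<in> ?Q" for X
    using that by (elim iq_carrierE) (simp add: iq_star_class iq_class_eq[OF iq_eq.idem])
  have invol: "?s (?s X Y) Y = X" if "X \<in> ?Q" "Y \<in> ?Q" for X Y
    using that
    by (elim iq_carrierE) (simp add: iq_star_class iq_class_eq[OF iq_eq.invol])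
  have dist: "?s (?s X Y) Z = ?s (?s X Z) (?s Y Z)" if "X \<in> ?Q" "Y \<in> ?Q" "Z \<in> ?Q" for X Y Z
    using that
    by (elim iq_carrierE) (simp add: iq_star_class, intro iq_class_eq iq_eq.dist)
  show ?thesis
  proof
    fix X Y assume XY: "X \<in> ?Q" "Y \<in> ?Q"
    show "\<exists>!Z. Z \<in> ?Q \<and> ?s Z Y = X"
      using XY closed invol by (intro ex1I[of _ "?s X Y"]) auto
  qed (fact closed idem invol dist)+
qed


section \<open>Diagrams\<close>

text \<open>
  A diagram is cut into segments, numbered by \<open>{..<segs D}\<close>. Each crossing is given by the two
  segments at the ends of its over-strand and the two at the ends of its under-strand; \<open>joins\<close>
  lists the pairs of segments that are glued end to end. The segments at the left and right
  boundary points are listed from top to bottom. A tangle diagram has \<open>lft D = [NW, SW]\<close> and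
  \<open>rgt D = [NE, SE]\<close>.
\<close>

datatype 'a crossing = Crossing (over1: 'a) (over2: 'a) (under1: 'a) (under2: 'a)

record diagram =
  segs :: nat
  joins :: "(nat \<times> nat) list"
  crossings :: "nat crossing list"
  lft :: "nat list"
  rgt :: "nat list"

abbreviation nw :: "diagram \<Rightarrow> nat" where "nw D \<equiv> lft D ! 0"
abbreviation sw :: "diagram \<Rightarrow> nat" where "sw D \<equiv> lft D ! 1"
abbreviation ne :: "diagram \<Rightarrow> nat" where "ne D \<equiv> rgt D ! 0"
abbreviation se :: "diagram \<Rightarrow> nat" where "se D \<equiv> rgt D ! 1"

text \<open>Renumbering, so that segments of two diagrams become disjoint.\<close>

definition shift :: "nat \<Rightarrow> diagram \<Rightarrow> diagram" where
  "shift k D = \<lparr>segs = segs D,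
     joins = map (map_prod ((+) k) ((+) k)) (joins D),
     crossings = map (map_crossing ((+) k)) (crossings D),
     lft = map ((+) k) (lft D), rgt = map ((+) k) (rgt D)\<rparr>"

text \<open>\<open>E\<close> to the right of \<open>D\<close>, for diagrams with the same number of strands.\<close>

definition beside :: "diagram \<Rightarrow> diagram \<Rightarrow> diagram" where
  "beside D E = (let E' = shift (segs D) E in
     \<lparr>segs = segs D + segs E,
      joins = joins D @ joins E' @ zip (rgt D) (lft E'),
      crossings = crossings D @ crossings E',
      lft = lft D, rgt = rgt E'\<rparr>)"

text \<open>The tangle \<open>E\<close> attached below the tangle \<open>D\<close>.\<close>

definition above :: "diagram \<Rightarrow> diagram \<Rightarrow> diagram" where
  "above D E = (let E' = shift (segs D) E in
     \<lparr>segs = segs D + segs E,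
      joins = joins D @ joins E' @ [(sw D, nw E'), (se D, ne E')],
      crossings = crossings D @ crossings E',
      lft = [nw D, sw E'], rgt = [ne D, se E']\<rparr>)"

text \<open>\<open>D\<close> over \<open>E\<close> in the plane, not connected to each other.\<close>

definition stack :: "diagram \<Rightarrow> diagram \<Rightarrow> diagram" where
  "stack D E = (let E' = shift (segs D) E in
     \<lparr>segs = segs D + segs E,
      joins = joins D @ joins E',
      crossings = crossings D @ crossings E',
      lft = lft D @ lft E', rgt = rgt D @ rgt E'\<rparr>)"

text \<open>Counterclockwise rotation of a tangle by a right angle: the \<open>NE\<close> endpoint moves to \<open>NW\<close>,
  \<open>NW\<close> to \<open>SW\<close>, \<open>SW\<close> to \<open>SE\<close> and \<open>SE\<close> to \<open>NE\<close>.\<close>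

definition rotate_tangle :: "diagram \<Rightarrow> diagram" where
  "rotate_tangle D = D\<lparr>lft := [ne D, nw D], rgt := [se D, sw D]\<rparr>"

definition braid_closure :: "diagram \<Rightarrow> diagram" where
  "braid_closure D = D\<lparr>joins := joins D @ zip (lft D) (rgt D), lft := [], rgt := []\<rparr>"

definition strand :: diagram where
  "strand = \<lparr>segs = 1, joins = [], crossings = [], lft = [0], rgt = [0]\<rparr>"

text \<open>In both crossings the segments \<open>0, 1, 2, 3\<close> are at \<open>NW, NE, SW, SE\<close>. The over-strand of
  \<open>neg_crossing\<close> runs from upper left to lower right, that of \<open>pos_crossing\<close> from lower left to
  upper right.\<close>

definition neg_crossing :: diagram where
  "neg_crossing = \<lparr>segs = 4, joins = [], crossings = [Crossing 0 3 2 1],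
     lft = [0, 2], rgt = [1, 3]\<rparr>"

definition pos_crossing :: diagram where
  "pos_crossing = \<lparr>segs = 4, joins = [], crossings = [Crossing 2 1 0 3],
     lft = [0, 2], rgt = [1, 3]\<rparr>"


section \<open>The involutory quandle of a link diagram\<close>

text \<open>Arcs are the classes of segments that are connected through joins and over-strands.\<close>

definition connections :: "diagram \<Rightarrow> (nat \<times> nat) set" where
  "connections D = set (joins D) \<union> (\<lambda>c. (over1 c, over2 c)) ` set (crossings D)"

definition arc_of :: "diagram \<Rightarrow> nat \<Rightarrow> nat set" where
  "arc_of D e = {e'. (e, e') \<in> (connections D \<union> (connections D)\<inverse>)\<^sup>*}"

definition arcs :: "diagram \<Rightarrow> nat set set" where
  "arcs D = arc_of D ` {..<segs D}"

definition crossing_relations :: "diagram \<Rightarrow> (nat set qterm \<times> nat set qterm) set" where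
  "crossing_relations D =
     (\<lambda>c. (Gen (arc_of D (under2 c)), Op (Gen (arc_of D (under1 c))) (Gen (arc_of D (over1 c)))))
       ` set (crossings D)"

definition IQ :: "diagram \<Rightarrow> nat set qterm set set" where
  "IQ D = iq_carrier (arcs D) (crossing_relations D)"

definition IQ_star :: "diagram \<Rightarrow>
    nat set qterm set \<Rightarrow> nat set qterm set \<Rightarrow> nat set qterm set" where
  "IQ_star D = iq_star (arcs D) (crossing_relations D)"


section \<open>Rational tangles of type 2\<close>

text \<open>A rational tangle of type 2 is represented by the list \<open>[a\<^sub>1, \<dots>, a\<^sub>m]\<close> of the terms of its
  continued fraction. Every negative rational number has exactly one expansion of this form.\<close>

definition type2 :: "int list \<Rightarrow> bool" where
  "type2 as \<longleftrightarrow> odd (length as) \<and> hd as \<le> 0 \<and> (\<forall>a\<in>set (tl as). a < 0) \<and>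
     (length as = 1 \<longrightarrow> hd as < 0)"

fun fraction :: "int list \<Rightarrow> rat" where
  "fraction [] = 0"
| "fraction [a] = of_int a"
| "fraction (a # b # as) = of_int a + 1 / fraction (b # as)"

fun tangle_row :: "nat \<Rightarrow> diagram" where
  "tangle_row 0 = stack strand strand"
| "tangle_row (Suc k) = beside (tangle_row k) neg_crossing"

text \<open>The column without crossings consists of two vertical segments.\<close>

fun tangle_column :: "nat \<Rightarrow> diagram" where
  "tangle_column 0 = \<lparr>segs = 2, joins = [], crossings = [], lft = [0, 0], rgt = [1, 1]\<rparr>"
| "tangle_column (Suc k) = above (tangle_column k) neg_crossing"

text \<open>Only lists of odd length are relevant; the first equation is a dummy value.\<close>

fun standard_diagram :: "int list \<Rightarrow> diagram" where
  "standard_diagram [] = tangle_row 0"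
| "standard_diagram [a] = tangle_row (nat \<bar>a\<bar>)"
| "standard_diagram (a # b # as) =
     beside (above (standard_diagram as) (tangle_column (nat \<bar>b\<bar>))) (tangle_row (nat \<bar>a\<bar>))"


section \<open>The links\<close>

abbreviation on12 :: "diagram \<Rightarrow> diagram" where "on12 T \<equiv> stack T strand"
abbreviation on23 :: "diagram \<Rightarrow> diagram" where "on23 T \<equiv> stack strand T"

definition concat_diagrams :: "diagram list \<Rightarrow> diagram" where
  "concat_diagrams Ds = foldr beside Ds (stack strand (stack strand strand))"

definition h_word :: "int \<Rightarrow> diagram list" where
  "h_word l = concat (replicate (nat \<bar>l\<bar>)
     (if l \<ge> 0 then [on12 pos_crossing, on23 pos_crossing]
      else [on23 neg_crossing, on12 neg_crossing]))"

definition link_diagram :: "(int list \<times> int list) list \<Rightarrow> int \<Rightarrow> diagram" where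
  "link_diagram ts l = braid_closure (concat_diagrams
     (h_word l @
      concat (map (\<lambda>(t, s).
        [on12 (rotate_tangle (standard_diagram t)), on23 (standard_diagram s)]) ts)))"

end

theory Submission
  imports Defs
begin

text \<open>
  Suppose that the involutory quandle of the link has a left-order. It is enough to show that all
  arcs have the same class: then the quandle has a single element, hence is trivial. The arcs with
  their classes form a coloring of the diagram by a left-ordered involutory quandle, and a left-order
  restricts such colorings severely: at every crossing the color of the over-arc lies strictly
  between those of the two under-arcs, or all three agree (\<open>over_between\<close>).

  In a rational tangle of type 2 this forces the colors of the endpoints to increase strictly
  from \<open>SW\<close> through \<open>NW\<close> and \<open>SE\<close> to \<open>NE\<close>, or to decrease in the same way, or else the whole
  tangle has one color (\<open>monotone_tangle_standard_diagram\<close>). Now read the triple of colors on the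
  three strands from left to right through the tangles \<open>t\<^sub>1, s\<^sub>1, \<dots>, t\<^sub>n, s\<^sub>n\<close>. Each tangle acts on the
  middle strand and an outer one and moves both colors down if the outer color is the larger one,
  and up if it is the smaller one. Consequently a triple whose middle color is lowest (a valley)
  stays a valley for ever, and likewise a peak; a strictly descending triple stays descending unless
  it becomes a valley or a peak (\<open>steady_tangle_part\<close>).

  The full twist acts on triples by \<open>x \<mapsto> ((x * a) * b) * c\<close>, where \<open>(a, b, c)\<close> is the triple that
  enters it. On the integers with \<open>x * y = 2 y - x\<close> it would reverse the order. In general it still
  maps no valley to a valley and no descending triple to a descending one (\<open>full_twist_valley\<close>,
  \<open>full_twist_descending\<close>). As the
  action of the full twist is an automorphism of the quandle, the coloring of the tangle part can be
  moved by its inverse, so that the moved copy starts with the triple with which the original ends.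
  A final triple that is a valley would therefore be a valley again one period later, although the
  two triples differ by a full twist. So the final triple is neither a valley nor a peak. If it were
  descending, so would be the initial triple, which again differs from it by a full twist. The same
  holds for the reversed order, so the final triple is constant, and then so is the coloring
  (\<open>full_twist_progress_constant\<close>). The two signs of the full twist are exchanged by turning the
  triples upside down, which preserves valleys and peaks and exchanges descending and ascending.
\<close>


section \<open>Colorings of diagrams\<close>

text \<open>Colors are also given to the numbers that are not segments, so that renumbering segments never
  leaves the quandle.\<close>

definition coloring :: "'a set \<Rightarrow> ('a \<Rightarrow> 'a \<Rightarrow> 'a) \<Rightarrow> diagram \<Rightarrow> (nat \<Rightarrow> 'a) \<Rightarrow> bool" where
  "coloring Q star D f \<longleftrightarrow> (\<forall>i. f i \<in> Q) \<and> (\<forall>(i, j)\<in>set (joins D). f i = f j) \<and>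
     (\<forall>c\<in>set (crossings D). f (over1 c) = f (over2 c) \<and>
        f (under2 c) = star (f (under1 c)) (f (over1 c)))"

definition well_formed :: "nat \<Rightarrow> diagram \<Rightarrow> bool" where
  "well_formed n D \<longleftrightarrow> set (joins D) \<subseteq> {..<segs D} \<times> {..<segs D} \<and>
     (\<Union>c\<in>set (crossings D). set_crossing c) \<subseteq> {..<segs D} \<and>
     set (lft D) \<subseteq> {..<segs D} \<and> set (rgt D) \<subseteq> {..<segs D} \<and>
     length (lft D) = n \<and> length (rgt D) = n"

definition constant_on :: "diagram \<Rightarrow> (nat \<Rightarrow> 'a) \<Rightarrow> 'a \<Rightarrow> bool" where
  "constant_on D f x \<longleftrightarrow> (\<forall>i<segs D. f i = x)"

lemma coloring_in: "coloring Q star D f \<Longrightarrow> f i \<in> Q"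
  by (simp add: coloring_def)

lemma well_formed_tangle:
  assumes "well_formed 2 D"
  shows "lft D = [nw D, sw D]" "rgt D = [ne D, se D]"
    "nw D < segs D" "sw D < segs D" "ne D < segs D" "se D < segs D"
proof -
  have *: "xs = [xs ! 0, xs ! 1] \<and> xs ! 0 < k \<and> xs ! 1 < k"
    if "length xs = 2" "set xs \<subseteq> {..<k}" for xs :: "nat list" and k
    using that by (auto simp: length_Suc_conv numeral_2_eq_2)
  show "lft D = [nw D, sw D]" "rgt D = [ne D, se D]"
    "nw D < segs D" "sw D < segs D" "ne D < segs D" "se D < segs D"
    using *[of "lft D" "segs D"] *[of "rgt D" "segs D"] assms unfolding well_formed_def by auto
qed

lemma constant_on_corners:
  assumes "well_formed 2 D" "constant_on D f x"
  shows "f (nw D) = x" "f (sw D) = x" "f (ne D) = x" "f (se D) = x"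
  using well_formed_tangle[OF assms(1)] assms(2) by (simp_all add: constant_on_def)

lemma constant_on_ends:
  assumes "well_formed 3 D" "constant_on D f x"
  shows "map f (lft D) = [x, x, x]" "map f (rgt D) = [x, x, x]"
proof -
  have *: "map f xs = [x, x, x]" if "length xs = 3" "set xs \<subseteq> {..<segs D}" for xs
    using that assms(2) by (auto simp: length_Suc_conv numeral_3_eq_3 constant_on_def)
  show "map f (lft D) = [x, x, x]" "map f (rgt D) = [x, x, x]"
    using assms(1) by (auto intro!: * simp: well_formed_def)
qed

lemma shift_simps [simp]:
  "segs (shift k D) = segs D"
  "joins (shift k D) = map (map_prod ((+) k) ((+) k)) (joins D)"
  "crossings (shift k D) = map (map_crossing ((+) k)) (crossings D)"
  "lft (shift k D) = map ((+) k) (lft D)" "rgt (shift k D) = map ((+) k) (rgt D)"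
  by (simp_all add: shift_def)

lemma beside_simps [simp]:
  "segs (beside D E) = segs D + segs E"
  "joins (beside D E) = joins D @ joins (shift (segs D) E) @ zip (rgt D) (lft (shift (segs D) E))"
  "crossings (beside D E) = crossings D @ crossings (shift (segs D) E)"
  "lft (beside D E) = lft D" "rgt (beside D E) = rgt (shift (segs D) E)"
  by (simp_all add: beside_def Let_def)

lemma above_simps [simp]:
  "segs (above D E) = segs D + segs E"
  "joins (above D E) = joins D @ joins (shift (segs D) E) @
     [(sw D, nw (shift (segs D) E)), (se D, ne (shift (segs D) E))]"
  "crossings (above D E) = crossings D @ crossings (shift (segs D) E)"
  "lft (above D E) = [nw D, sw (shift (segs D) E)]"
  "rgt (above D E) = [ne D, se (shift (segs D) E)]"
  by (simp_all add: above_def Let_def)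

lemma stack_simps [simp]:
  "segs (stack D E) = segs D + segs E"
  "joins (stack D E) = joins D @ joins (shift (segs D) E)"
  "crossings (stack D E) = crossings D @ crossings (shift (segs D) E)"
  "lft (stack D E) = lft D @ lft (shift (segs D) E)"
  "rgt (stack D E) = rgt D @ rgt (shift (segs D) E)"
  by (simp_all add: stack_def Let_def)

lemma rotate_tangle_simps [simp]:
  "segs (rotate_tangle D) = segs D" "joins (rotate_tangle D) = joins D"
  "crossings (rotate_tangle D) = crossings D"
  "lft (rotate_tangle D) = [ne D, nw D]" "rgt (rotate_tangle D) = [se D, sw D]"
  by (simp_all add: rotate_tangle_def)

lemma strand_simps [simp]:
  "segs strand = 1" "joins strand = []" "crossings strand = []"
  "lft strand = [0]" "rgt strand = [0]"
  by (simp_all add: strand_def)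

lemma well_formed_shift:
  assumes "well_formed n D"
  shows "set (joins (shift k D)) \<subseteq> {..<k + segs D} \<times> {..<k + segs D}"
    "(\<Union>c\<in>set (crossings (shift k D)). set_crossing c) \<subseteq> {..<k + segs D}"
    "set (lft (shift k D)) \<subseteq> {..<k + segs D}" "set (rgt (shift k D)) \<subseteq> {..<k + segs D}"
  using assms unfolding well_formed_def by (auto simp: crossing.set_map)

lemma well_formed_weaken:
  assumes "well_formed n D"
  shows "set (joins D) \<subseteq> {..<segs D + k} \<times> {..<segs D + k}"
    "(\<Union>c\<in>set (crossings D). set_crossing c) \<subseteq> {..<segs D + k}"
    "set (lft D) \<subseteq> {..<segs D + k}" "set (rgt D) \<subseteq> {..<segs D + k}"
proof -
  have k: "{..<segs D} \<subseteq> {..<segs D + k}"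
    by auto
  show "set (joins D) \<subseteq> {..<segs D + k} \<times> {..<segs D + k}"
    "(\<Union>c\<in>set (crossings D). set_crossing c) \<subseteq> {..<segs D + k}"
    "set (lft D) \<subseteq> {..<segs D + k}" "set (rgt D) \<subseteq> {..<segs D + k}"
    using assms subset_trans[OF _ k] subset_trans[OF _ Sigma_mono[OF k k]]
    unfolding well_formed_def by simp_all
qed

lemma set_zip_subset: "set xs \<subseteq> A \<Longrightarrow> set ys \<subseteq> B \<Longrightarrow> set (zip xs ys) \<subseteq> A \<times> B"
  by (auto dest: set_zip_leftD set_zip_rightD)

lemma well_formed_beside:
  assumes D: "well_formed n D" and E: "well_formed n E"
  shows "well_formed n (beside D E)"
proof -
  note * = well_formed_weaken[OF D, of "segs E"] well_formed_shift[OF E, of "segs D"]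
  show ?thesis
    using * set_zip_subset[OF *(4) *(7)] D E
    unfolding well_formed_def[of _ "beside D E"] beside_simps set_append UN_Un
    by (simp add: well_formed_def)
qed

lemma well_formed_stack:
  assumes D: "well_formed m D" and E: "well_formed n E"
  shows "well_formed (m + n) (stack D E)"
  using well_formed_weaken[OF D, of "segs E"] well_formed_shift[OF E, of "segs D"] D E
  unfolding well_formed_def[of _ "stack D E"] stack_simps set_append UN_Un
  by (simp add: well_formed_def)

lemma well_formed_above:
  assumes D: "well_formed 2 D" and E: "well_formed 2 E"
  shows "well_formed 2 (above D E)"
  using well_formed_weaken[OF D, of "segs E"] well_formed_shift[OF E, of "segs D"]
    well_formed_tangle[OF D] well_formed_tangle[OF E] D E
  unfolding well_formed_def[of _ "above D E"] above_simps set_append UN_Un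
  by (simp add: well_formed_def)

lemma well_formed_rotate_tangle: "well_formed 2 D \<Longrightarrow> well_formed 2 (rotate_tangle D)"
  using well_formed_tangle[of D] unfolding well_formed_def by simp

lemma well_formed_strand: "well_formed 1 strand"
  by (simp add: well_formed_def)

lemma well_formed_crossing:
  "well_formed 2 neg_crossing" "well_formed 2 pos_crossing"
  by (simp_all add: well_formed_def neg_crossing_def pos_crossing_def)

lemma well_formed_braid_closure: "well_formed n D \<Longrightarrow> well_formed 0 (braid_closure D)"
  unfolding well_formed_def braid_closure_def
  using set_zip_subset[of "lft D" _ "rgt D"] by simp

text \<open>A piece of a composite diagram is colored by restriction, with the renumbering undone. The
  hypotheses on \<open>X\<close> cover all three ways of composing \<open>D\<close> and \<open>E\<close>.\<close>

lemma coloring_parts: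
  assumes "coloring Q star X f"
    and "set (joins D) \<union> set (joins (shift (segs D) E)) \<subseteq> set (joins X)"
    and "set (crossings D) \<union> set (crossings (shift (segs D) E)) \<subseteq> set (crossings X)"
  shows "coloring Q star D f" "coloring Q star E (\<lambda>i. f (segs D + i))"
proof -
  show "coloring Q star D f"
    using assms unfolding coloring_def by blast
  have "f (segs D + i) = f (segs D + j)" if "(i, j) \<in> set (joins E)" for i j
  proof -
    have "(segs D + i, segs D + j) \<in> set (joins X)"
      using assms(2) that by force
    then show ?thesis
      using assms(1) by (auto simp: coloring_def)
  qed
  moreover have "f (segs D + over1 c) = f (segs D + over2 c) \<and>
      f (segs D + under2 c) = star (f (segs D + under1 c)) (f (segs D + over1 c))"
    if "c \<in> set (crossings E)" for c
  proof -
    have "map_crossing ((+) (segs D)) c \<in> set (crossings X)"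
      using assms(3) that by auto
    then have "f (over1 (map_crossing ((+) (segs D)) c)) = f (over2 (map_crossing ((+) (segs D)) c)) \<and>
      f (under2 (map_crossing ((+) (segs D)) c)) =
        star (f (under1 (map_crossing ((+) (segs D)) c))) (f (over1 (map_crossing ((+) (segs D)) c)))"
      using assms(1) unfolding coloring_def by blast
    then show ?thesis
      by (simp add: crossing.map_sel)
  qed
  ultimately show "coloring Q star E (\<lambda>i. f (segs D + i))"
    using assms(1) by (auto simp: coloring_def)
qed

lemma coloring_beside:
  assumes "coloring Q star (beside D E) f"
  shows "coloring Q star D f" "coloring Q star E (\<lambda>i. f (segs D + i))"
  by (rule coloring_parts[OF assms]; auto)+

lemma coloring_above:
  assumes "coloring Q star (above D E) f"
  shows "coloring Q star D f" "coloring Q star E (\<lambda>i. f (segs D + i))"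
  by (rule coloring_parts[OF assms]; auto)+

lemma coloring_stack:
  assumes "coloring Q star (stack D E) f"
  shows "coloring Q star D f" "coloring Q star E (\<lambda>i. f (segs D + i))"
  by (rule coloring_parts[OF assms]; auto)+

lemma coloring_join: "coloring Q star D f \<Longrightarrow> (i, j) \<in> set (joins D) \<Longrightarrow> f i = f j"
  unfolding coloring_def by blast

lemma coloring_beside_glue:
  assumes "coloring Q star (beside D E) f" "well_formed n D" "well_formed n E" "k < n"
  shows "f (segs D + lft E ! k) = f (rgt D ! k)"
proof -
  have "(rgt D ! k, segs D + lft E ! k) \<in> set (zip (rgt D) (map ((+) (segs D)) (lft E)))"
    using assms(2-4) by (auto simp: set_zip well_formed_def intro!: exI[of _ k])
  then have "(rgt D ! k, segs D + lft E ! k) \<in> set (joins (beside D E))"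
    by simp
  then show ?thesis
    using coloring_join[OF assms(1)] by simp
qed

lemma coloring_above_glue:
  assumes "coloring Q star (above D E) f" "well_formed 2 E"
  shows "f (segs D + nw E) = f (sw D)" "f (segs D + ne E) = f (se D)"
  using assms well_formed_def[of 2 E] by (auto simp: coloring_def)

lemma constant_on_append:
  assumes "segs X = segs D + segs E"
    and "constant_on D f x" "constant_on E (\<lambda>i. f (segs D + i)) x"
  shows "constant_on X f x"
  unfolding constant_on_def
proof (intro allI impI)
  fix i assume "i < segs X"
  then show "f i = x"
    using assms by (cases "i < segs D")
      (auto simp: constant_on_def dest!: spec[of _ "i - segs D"])
qed


section \<open>Left-ordered involutory quandles\<close>

locale left_ordered_quandle = involutory_quandle Q star
  for Q :: "'a set" and star (infixl "\<star>" 70) +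
  fixes lt :: "'a \<Rightarrow> 'a \<Rightarrow> bool" (infix "\<prec>" 50)
  assumes left_order: "left_order Q star lt"
begin

lemma lt_irrefl: "x \<in> Q \<Longrightarrow> \<not> x \<prec> x"
  and lt_trans: "\<lbrakk>x \<prec> y; y \<prec> z; x \<in> Q; y \<in> Q; z \<in> Q\<rbrakk> \<Longrightarrow> x \<prec> z"
  and lt_total: "\<lbrakk>x \<in> Q; y \<in> Q\<rbrakk> \<Longrightarrow> x = y \<or> x \<prec> y \<or> y \<prec> x"
  and star_mono: "\<lbrakk>x \<prec> y; x \<in> Q; y \<in> Q; z \<in> Q\<rbrakk> \<Longrightarrow> z \<star> x \<prec> z \<star> y"
  using left_order unfolding left_order_def by blast+

lemma lt_asym: "\<lbrakk>x \<prec> y; x \<in> Q; y \<in> Q\<rbrakk> \<Longrightarrow> \<not> y \<prec> x"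
  using lt_irrefl[of x] lt_trans[of x y x] by blast

text \<open>Every statement about the order also holds for the reversed order; this halves the case
  distinctions below.\<close>

lemma dual: "left_ordered_quandle Q star (\<lambda>x y. y \<prec> x)"
proof
  show "left_order Q star (\<lambda>x y. y \<prec> x)"
    unfolding left_order_def
  proof (intro conjI ballI impI)
    show "z \<prec> x" if "y \<prec> x" "z \<prec> y" "x \<in> Q" "y \<in> Q" "z \<in> Q" for x y z
      using lt_trans[of z y x] that by blast
  qed (use lt_irrefl lt_total star_mono in blast)+
qed

text \<open>The two under-arcs at \<open>y\<close> have the colors \<open>x\<close> and \<open>z = x \<star> y\<close>, and \<open>z \<star> y = x\<close>. Multiplying \<open>x \<prec> y\<close> from the
  left by \<open>x\<close> gives \<open>x \<prec> z\<close>. If \<open>z\<close> were below \<open>y\<close> too, the same argument at \<open>z\<close> would give \<open>z \<prec> x\<close>.\<close>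

lemma over_between:
  assumes "x \<in> Q" "y \<in> Q" "x \<prec> y"
  shows "y \<prec> x \<star> y"
proof -
  let ?z = "x \<star> y"
  have z: "?z \<in> Q" "?z \<star> y = x"
    using assms closed invol by auto
  have "x \<prec> ?z"
    using star_mono[of x y x] assms idem by simp
  moreover have "?z \<prec> x" if "?z \<prec> y"
    using star_mono[of ?z y ?z] that z assms idem by simp
  moreover have "x = y" if "?z = y"
    using z(2) that idem assms(2) by simp
  ultimately show ?thesis
    using lt_total[of ?z y] lt_asym[of x ?z] lt_irrefl assms z by blast
qed

lemma over_between':
  assumes "x \<in> Q" "y \<in> Q" "y \<prec> x"
  shows "x \<star> y \<prec> y"
  using left_ordered_quandle.over_between[OF dual] assms by blast

end


section \<open>Colorings of rational tangles\<close>

definition rising :: "('a \<Rightarrow> 'a \<Rightarrow> bool) \<Rightarrow> diagram \<Rightarrow> (nat \<Rightarrow> 'a) \<Rightarrow> bool" where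
  "rising lt D f \<longleftrightarrow> lt (f (sw D)) (f (nw D)) \<and> lt (f (sw D)) (f (se D)) \<and>
     lt (f (nw D)) (f (ne D)) \<and> lt (f (se D)) (f (ne D))"

context left_ordered_quandle
begin

definition monotone_tangle :: "diagram \<Rightarrow> bool" where
  "monotone_tangle D \<longleftrightarrow> well_formed 2 D \<and> (\<forall>f. coloring Q star D f \<longrightarrow>
     rising lt D f \<or> rising (\<lambda>x y. lt y x) D f \<or> (\<exists>x. constant_on D f x))"

lemma monotone_tangle_neg_crossing: "monotone_tangle neg_crossing"
  unfolding monotone_tangle_def
proof (intro conjI allI impI)
  fix f assume f: "coloring Q star neg_crossing f"
  then have eq: "f 3 = f 0" "f 1 = f 2 \<star> f 0" and Q: "f i \<in> Q" for i
    by (simp_all add: coloring_def neg_crossing_def)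
  consider "f 2 \<prec> f 0" | "f 0 \<prec> f 2" | "f 2 = f 0"
    using lt_total Q by blast
  then show "rising lt neg_crossing f \<or> rising (\<lambda>x y. lt y x) neg_crossing f \<or>
      (\<exists>x. constant_on neg_crossing f x)"
  proof cases
    case 3
    then have "f 0 = f 1"
      using eq(2) idem Q by simp
    then have "constant_on neg_crossing f (f 0)"
      using 3 eq(1) by (auto simp: constant_on_def neg_crossing_def less_Suc_eq numeral_eq_Suc)
    then show ?thesis by blast
  qed (use over_between[OF Q Q] over_between'[OF Q Q] eq in
      \<open>simp_all add: rising_def neg_crossing_def\<close>)
qed (rule well_formed_crossing)

text \<open>Two tangles glued along a side share two colors \<open>p\<close> and \<open>q\<close>, and the direction in which the colors
  of either tangle change can be read off from the comparison of \<open>p\<close> with \<open>q\<close>. Hence the directions agree.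
  The two alternatives for \<open>adj\<close> are horizontal and vertical gluing.\<close>

lemma monotone_tangle_compose:
  assumes D: "monotone_tangle D" "coloring Q star D f"
    and E: "monotone_tangle E" "coloring Q star E g"
    and adj: "f (ne D) = g (nw E) \<and> f (se D) = g (sw E) \<or> f (sw D) = g (nw E) \<and> f (se D) = g (ne E)"
  shows "rising lt D f \<and> rising lt E g \<or>
    rising (\<lambda>x y. lt y x) D f \<and> rising (\<lambda>x y. lt y x) E g \<or>
    (\<exists>x. constant_on D f x \<and> constant_on E g x)"
proof -
  have Q: "f i \<in> Q" "g i \<in> Q" for i
    by (rule coloring_in[OF D(2)], rule coloring_in[OF E(2)])
  have wf: "well_formed 2 D" "well_formed 2 E"
    using D E by (simp_all add: monotone_tangle_def)
  have c: "f (nw D) = x \<and> f (sw D) = x \<and> f (ne D) = x \<and> f (se D) = x" if "constant_on D f x" for x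
    using constant_on_corners[OF wf(1) that] by simp
  have c': "g (nw E) = x \<and> g (sw E) = x \<and> g (ne E) = x \<and> g (se E) = x" if "constant_on E g x" for x
    using constant_on_corners[OF wf(2) that] by simp
  from D E have "rising lt D f \<or> rising (\<lambda>x y. lt y x) D f \<or> (\<exists>x. constant_on D f x)"
    "rising lt E g \<or> rising (\<lambda>x y. lt y x) E g \<or> (\<exists>x. constant_on E g x)"
    unfolding monotone_tangle_def by blast+
  moreover obtain p q where "p \<in> Q" "q \<in> Q"
    "rising lt D f \<longrightarrow> p \<prec> q" "rising (\<lambda>x y. lt y x) D f \<longrightarrow> q \<prec> p" "\<forall>x. constant_on D f x \<longrightarrow> p = x \<and> q = x"
    "rising lt E g \<longrightarrow> p \<prec> q" "rising (\<lambda>x y. lt y x) E g \<longrightarrow> q \<prec> p" "\<forall>x. constant_on E g x \<longrightarrow> p = x \<and> q = x"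
    using adj
  proof
    assume "f (ne D) = g (nw E) \<and> f (se D) = g (sw E)"
    then show thesis
      using Q by (intro that[of "f (se D)" "f (ne D)"]) (auto simp: rising_def dest: c c')
  next
    assume "f (sw D) = g (nw E) \<and> f (se D) = g (ne E)"
    then show thesis
      using Q by (intro that[of "f (sw D)" "f (se D)"]) (auto simp: rising_def dest: c c')
  qed
  ultimately show ?thesis
    using lt_asym[of p q] lt_irrefl[of p] by metis
qed

lemma monotone_tangle_beside:
  assumes "monotone_tangle D" "monotone_tangle E"
  shows "monotone_tangle (beside D E)"
  unfolding monotone_tangle_def
proof (intro conjI allI impI)
  have wf: "well_formed 2 D" "well_formed 2 E"
    using assms by (auto simp: monotone_tangle_def)
  then show "well_formed 2 (beside D E)"
    by (rule well_formed_beside)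
  fix f assume f: "coloring Q star (beside D E) f"
  let ?g = "\<lambda>i. f (segs D + i)"
  note fg = coloring_beside[OF f]
  have Q: "f i \<in> Q" for i
    by (rule coloring_in[OF f])
  have glue: "f (ne D) = ?g (nw E)" "f (se D) = ?g (sw E)"
    using coloring_beside_glue[OF f wf] by simp_all
  have ends: "nw (beside D E) = nw D" "sw (beside D E) = sw D"
    "ne (beside D E) = segs D + ne E" "se (beside D E) = segs D + se E"
    using wf by (auto simp: well_formed_def)
  from monotone_tangle_compose[OF assms(1) fg(1) assms(2) fg(2)] glue
  consider "rising lt D f" "rising lt E ?g" | "rising (\<lambda>x y. lt y x) D f" "rising (\<lambda>x y. lt y x) E ?g"
    | x where "constant_on D f x" "constant_on E ?g x"
    by blast
  then show "rising lt (beside D E) f \<or> rising (\<lambda>x y. lt y x) (beside D E) f \<or>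
      (\<exists>x. constant_on (beside D E) f x)"
  proof cases
    case 1
    then show ?thesis
      using lt_trans[of "f (nw D)" "f (ne D)" "?g (ne E)"]
        lt_trans[of "f (sw D)" "f (se D)" "?g (se E)"] glue Q
      unfolding rising_def ends by simp
  next
    case 2
    then show ?thesis
      using lt_trans[of "?g (ne E)" "f (ne D)" "f (nw D)"]
        lt_trans[of "?g (se E)" "f (se D)" "f (sw D)"] glue Q
      unfolding rising_def ends by simp
  next
    case 3
    then show ?thesis
      using constant_on_append[of "beside D E" D E f] by auto
  qed
qed

lemma monotone_tangle_above:
  assumes "monotone_tangle D" "monotone_tangle E"
  shows "monotone_tangle (above D E)"
  unfolding monotone_tangle_def
proof (intro conjI allI impI)
  have wf: "well_formed 2 D" "well_formed 2 E"
    using assms by (auto simp: monotone_tangle_def)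
  then show "well_formed 2 (above D E)"
    by (rule well_formed_above)
  fix f assume f: "coloring Q star (above D E) f"
  let ?g = "\<lambda>i. f (segs D + i)"
  note fg = coloring_above[OF f]
  have Q: "f i \<in> Q" for i
    by (rule coloring_in[OF f])
  have glue: "f (sw D) = ?g (nw E)" "f (se D) = ?g (ne E)"
    using coloring_above_glue[OF f wf(2)] by auto
  have ends: "nw (above D E) = nw D" "sw (above D E) = segs D + sw E"
    "ne (above D E) = ne D" "se (above D E) = segs D + se E"
    using wf by (auto simp: well_formed_def)
  from monotone_tangle_compose[OF assms(1) fg(1) assms(2) fg(2)] glue
  consider "rising lt D f" "rising lt E ?g" | "rising (\<lambda>x y. lt y x) D f" "rising (\<lambda>x y. lt y x) E ?g"
    | x where "constant_on D f x" "constant_on E ?g x"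
    by blast
  then show "rising lt (above D E) f \<or> rising (\<lambda>x y. lt y x) (above D E) f \<or>
      (\<exists>x. constant_on (above D E) f x)"
  proof cases
    case 1
    then show ?thesis
      using lt_trans[of "?g (sw E)" "f (sw D)" "f (nw D)"]
        lt_trans[of "?g (se E)" "f (se D)" "f (ne D)"] glue Q
      unfolding rising_def ends by simp
  next
    case 2
    then show ?thesis
      using lt_trans[of "f (nw D)" "f (sw D)" "?g (sw E)"]
        lt_trans[of "f (ne D)" "f (se D)" "?g (se E)"] glue Q
      unfolding rising_def ends by simp
  next
    case 3
    then show ?thesis
      using constant_on_append[of "above D E" D E f] by auto
  qed
qed

text \<open>A row or column without crossings is not monotone in general, as the colors of its endpoints
  agree in pairs. The next lemma serves to remove it from one side of a monotone tangle.\<close>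

lemma monotone_tangle_cong:
  assumes "monotone_tangle D" "well_formed 2 X"
    and "\<And>f. coloring Q star X f \<Longrightarrow> \<exists>g. coloring Q star D g \<and>
      g (nw D) = f (nw X) \<and> g (sw D) = f (sw X) \<and> g (ne D) = f (ne X) \<and> g (se D) = f (se X) \<and>
      (\<forall>x. constant_on D g x \<longrightarrow> constant_on X f x)"
  shows "monotone_tangle X"
  unfolding monotone_tangle_def
proof (intro conjI allI impI)
  fix f assume "coloring Q star X f"
  from assms(3)[OF this] obtain g where g: "coloring Q star D g"
    "g (nw D) = f (nw X)" "g (sw D) = f (sw X)" "g (ne D) = f (ne X)" "g (se D) = f (se X)"
    "\<forall>x. constant_on D g x \<longrightarrow> constant_on X f x"
    by blast
  have "rising lt D g \<or> rising (\<lambda>x y. lt y x) D g \<or> (\<exists>x. constant_on D g x)"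
    using assms(1) g(1) unfolding monotone_tangle_def by blast
  then show "rising lt X f \<or> rising (\<lambda>x y. lt y x) X f \<or> (\<exists>x. constant_on X f x)"
    using g(6) unfolding rising_def g(2-5) by blast
qed (fact assms(2))

lemma well_formed_empty_row: "well_formed 2 (tangle_row 0)"
  using well_formed_stack[OF well_formed_strand well_formed_strand] by (simp add: numeral_2_eq_2)

lemma well_formed_empty_column: "well_formed 2 (tangle_column 0)"
  by (simp add: well_formed_def)

lemma monotone_tangle_empty_row_left:
  assumes "monotone_tangle D"
  shows "monotone_tangle (beside (tangle_row 0) D)"
proof (rule monotone_tangle_cong[OF assms])
  have wf: "well_formed 2 (tangle_row 0)" "well_formed 2 D"
    using assms well_formed_empty_row by (auto simp: monotone_tangle_def)
  then show "well_formed 2 (beside (tangle_row 0) D)"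
    by (rule well_formed_beside)
  fix f assume f: "coloring Q star (beside (tangle_row 0) D) f"
  let ?g = "\<lambda>i. f (segs (tangle_row 0) + i)"
  have glue: "f (2 + nw D) = f 0" "f (2 + sw D) = f 1"
    using coloring_beside_glue[OF f wf, of 0] coloring_beside_glue[OF f wf, of 1] by simp_all
  show "\<exists>g. coloring Q star D g \<and>
      g (nw D) = f (nw (beside (tangle_row 0) D)) \<and> g (sw D) = f (sw (beside (tangle_row 0) D)) \<and>
      g (ne D) = f (ne (beside (tangle_row 0) D)) \<and> g (se D) = f (se (beside (tangle_row 0) D)) \<and>
      (\<forall>x. constant_on D g x \<longrightarrow> constant_on (beside (tangle_row 0) D) f x)"
  proof (intro exI[of _ ?g] conjI allI impI)
    show "coloring Q star D ?g"
      by (rule coloring_beside(2)[OF f])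
    fix x assume x: "constant_on D ?g x"
    then have "f 0 = x" "f 1 = x"
      using glue well_formed_tangle[OF wf(2)] by (auto simp: constant_on_def)
    then have empty: "constant_on (tangle_row 0) f x"
      by (auto simp: constant_on_def less_Suc_eq)
    show "constant_on (beside (tangle_row 0) D) f x"
      by (rule constant_on_append[OF beside_simps(1) empty x])
  qed (use glue wf in \<open>simp_all add: well_formed_def\<close>)
qed

lemma monotone_tangle_empty_row_right:
  assumes "monotone_tangle D"
  shows "monotone_tangle (beside D (tangle_row 0))"
proof (rule monotone_tangle_cong[OF assms])
  have wf: "well_formed 2 D" "well_formed 2 (tangle_row 0)"
    using assms well_formed_empty_row by (auto simp: monotone_tangle_def)
  then show "well_formed 2 (beside D (tangle_row 0))"
    by (rule well_formed_beside)
  fix f assume f: "coloring Q star (beside D (tangle_row 0)) f"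
  have glue: "f (segs D) = f (ne D)" "f (segs D + 1) = f (se D)"
    using coloring_beside_glue[OF f wf, of 0] coloring_beside_glue[OF f wf, of 1] by simp_all
  show "\<exists>g. coloring Q star D g \<and>
      g (nw D) = f (nw (beside D (tangle_row 0))) \<and> g (sw D) = f (sw (beside D (tangle_row 0))) \<and>
      g (ne D) = f (ne (beside D (tangle_row 0))) \<and> g (se D) = f (se (beside D (tangle_row 0))) \<and>
      (\<forall>x. constant_on D g x \<longrightarrow> constant_on (beside D (tangle_row 0)) f x)"
  proof (intro exI[of _ f] conjI allI impI)
    show "coloring Q star D f"
      by (rule coloring_beside(1)[OF f])
    fix x assume x: "constant_on D f x"
    then have "f (segs D) = x" "f (segs D + 1) = x"
      using glue well_formed_tangle[OF wf(1)] by (auto simp: constant_on_def)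
    then have empty: "constant_on (tangle_row 0) (\<lambda>i. f (segs D + i)) x"
      by (auto simp: constant_on_def less_Suc_eq)
    show "constant_on (beside D (tangle_row 0)) f x"
      by (rule constant_on_append[OF beside_simps(1) x empty])
  qed (use glue wf in \<open>simp_all add: well_formed_def\<close>)
qed

lemma monotone_tangle_empty_column_above:
  assumes "monotone_tangle D"
  shows "monotone_tangle (above (tangle_column 0) D)"
proof (rule monotone_tangle_cong[OF assms])
  have wf: "well_formed 2 (tangle_column 0)" "well_formed 2 D"
    using assms well_formed_empty_column by (auto simp: monotone_tangle_def)
  then show "well_formed 2 (above (tangle_column 0) D)"
    by (rule well_formed_above)
  fix f assume f: "coloring Q star (above (tangle_column 0) D) f"
  let ?g = "\<lambda>i. f (segs (tangle_column 0) + i)"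
  have glue: "f (2 + nw D) = f 0" "f (2 + ne D) = f 1"
    using coloring_above_glue[OF f wf(2)] by simp_all
  show "\<exists>g. coloring Q star D g \<and>
      g (nw D) = f (nw (above (tangle_column 0) D)) \<and> g (sw D) = f (sw (above (tangle_column 0) D)) \<and>
      g (ne D) = f (ne (above (tangle_column 0) D)) \<and> g (se D) = f (se (above (tangle_column 0) D)) \<and>
      (\<forall>x. constant_on D g x \<longrightarrow> constant_on (above (tangle_column 0) D) f x)"
  proof (intro exI[of _ ?g] conjI allI impI)
    show "coloring Q star D ?g"
      by (rule coloring_above(2)[OF f])
    fix x assume x: "constant_on D ?g x"
    then have "f 0 = x" "f 1 = x"
      using glue well_formed_tangle[OF wf(2)] by (auto simp: constant_on_def)
    then have empty: "constant_on (tangle_column 0) f x"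
      by (auto simp: constant_on_def less_Suc_eq numeral_2_eq_2)
    show "constant_on (above (tangle_column 0) D) f x"
      by (rule constant_on_append[OF above_simps(1) empty x])
  qed (use glue wf in \<open>simp_all add: well_formed_def\<close>)
qed

lemma monotone_tangle_row: "0 < k \<Longrightarrow> monotone_tangle (tangle_row k)"
proof (induction k)
  case (Suc k)
  show ?case
  proof (cases "k = 0")
    case True
    then show ?thesis
      using monotone_tangle_empty_row_left[OF monotone_tangle_neg_crossing] by simp
  next
    case False
    then show ?thesis
      using monotone_tangle_beside Suc.IH monotone_tangle_neg_crossing by simp
  qed
qed simp

lemma monotone_tangle_column: "0 < k \<Longrightarrow> monotone_tangle (tangle_column k)"
proof (induction k)
  case (Suc k)
  show ?case
  proof (cases "k = 0")
    case True
    then show ?thesis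
      using monotone_tangle_empty_column_above[OF monotone_tangle_neg_crossing] by simp
  next
    case False
    then show ?thesis
      using monotone_tangle_above Suc.IH monotone_tangle_neg_crossing by simp
  qed
qed simp

text \<open>The only row without crossings that can occur belongs to \<open>a\<^sub>1 = 0\<close>; all inner coefficients are
  negative.\<close>

lemma monotone_tangle_standard_diagram:
  "type2 as \<Longrightarrow> monotone_tangle (standard_diagram as)"
proof (induction as rule: standard_diagram.induct)
  case (3 a b as)
  have "as \<noteq> []"
    using "3.prems" by (auto simp: type2_def)
  then have "type2 as"
    using "3.prems" by (cases as) (auto simp: type2_def)
  then have "monotone_tangle (above (standard_diagram as) (tangle_column (nat \<bar>b\<bar>)))"
    using "3.prems" by (intro monotone_tangle_above "3.IH" monotone_tangle_column)
      (auto simp: type2_def)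
  then show ?case
    using monotone_tangle_beside monotone_tangle_row[of "nat \<bar>a\<bar>"] monotone_tangle_empty_row_right
    by (cases "a = 0") simp_all
qed (auto simp: type2_def intro: monotone_tangle_row)

end


section \<open>Color triples along the tangle part\<close>

text \<open>The shape of a triple of colors. Valleys include the cases where the middle color equals exactly
  one of the outer ones: a tangle between the two strands of equal color does nothing, and one
  between the other two makes the valley strict.\<close>

definition valley :: "('a \<Rightarrow> 'a \<Rightarrow> bool) \<Rightarrow> 'a list \<Rightarrow> bool" where
  "valley lt v \<longleftrightarrow> \<not> lt (v ! 0) (v ! 1) \<and> \<not> lt (v ! 2) (v ! 1) \<and> \<not> (v ! 0 = v ! 1 \<and> v ! 1 = v ! 2)"

abbreviation peak :: "('a \<Rightarrow> 'a \<Rightarrow> bool) \<Rightarrow> 'a list \<Rightarrow> bool" where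
  "peak lt \<equiv> valley (\<lambda>x y. lt y x)"

definition descending :: "('a \<Rightarrow> 'a \<Rightarrow> bool) \<Rightarrow> 'a list \<Rightarrow> bool" where
  "descending lt v \<longleftrightarrow> lt (v ! 1) (v ! 0) \<and> lt (v ! 2) (v ! 1)"

abbreviation ascending :: "('a \<Rightarrow> 'a \<Rightarrow> bool) \<Rightarrow> 'a list \<Rightarrow> bool" where
  "ascending lt \<equiv> descending (\<lambda>x y. lt y x)"

text \<open>How the shape of a triple may change along a tangle.\<close>

definition progress :: "('a \<Rightarrow> 'a \<Rightarrow> bool) \<Rightarrow> 'a list \<Rightarrow> 'a list \<Rightarrow> bool" where
  "progress lt v w \<longleftrightarrow> (valley lt v \<longrightarrow> valley lt w) \<and> (peak lt v \<longrightarrow> peak lt w) \<and>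
     (descending lt v \<longrightarrow> descending lt w \<or> valley lt w \<or> peak lt w) \<and>
     (ascending lt v \<longrightarrow> ascending lt w \<or> valley lt w \<or> peak lt w)"

lemma progress_refl: "progress lt v v"
  by (simp add: progress_def)

lemma progress_trans: "progress lt u v \<Longrightarrow> progress lt v w \<Longrightarrow> progress lt u w"
  unfolding progress_def by blast

lemma progress_dual: "progress (\<lambda>x y. lt y x) v w \<longleftrightarrow> progress lt v w"
  unfolding progress_def by auto

lemma valley_rev: "valley lt [c, b, a] \<longleftrightarrow> valley lt [a, b, c]"
  and descending_rev: "descending lt [c, b, a] \<longleftrightarrow> ascending lt [a, b, c]"
  by (auto simp: valley_def descending_def)

lemma progress_rev: "progress lt [c, b, a] [c', b', a'] \<longleftrightarrow> progress lt [a, b, c] [a', b', c']"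
  using valley_rev[of lt c b a] valley_rev[of "\<lambda>x y. lt y x" c b a]
    valley_rev[of lt c' b' a'] valley_rev[of "\<lambda>x y. lt y x" c' b' a']
    descending_rev[of lt c b a] descending_rev[of lt a b c]
    descending_rev[of lt c' b' a'] descending_rev[of lt a' b' c']
  unfolding progress_def by blast

context left_ordered_quandle
begin

text \<open>Here \<open>x\<close> is the color of the outer strand and \<open>y\<close> that of the middle strand at a tangle that moves
  both colors down. The third color \<open>z\<close> does not change, so the middle color can only drop below it.\<close>

lemma progress_step:
  assumes "y \<prec> x \<and> y' \<prec> x' \<and> x' \<prec> x \<and> y' \<prec> y"
    and Q: "x \<in> Q" "y \<in> Q" "z \<in> Q" "x' \<in> Q" "y' \<in> Q"
  shows "progress lt [x, y, z] [x', y', z]"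
  using assms lt_asym[of y x] lt_asym[of y' x'] lt_total[of z y'] lt_trans[of z y' y] lt_irrefl[of x']
  unfolding progress_def valley_def descending_def by auto

end

lemma (in left_ordered_quandle) progress_twist:
  assumes "y \<prec> x \<and> y' \<prec> x' \<and> x' \<prec> x \<and> y' \<prec> y \<or>
      x \<prec> y \<and> x' \<prec> y' \<and> x \<prec> x' \<and> y \<prec> y' \<or> x = y \<and> x' = x \<and> y' = x"
    and Q: "x \<in> Q" "y \<in> Q" "z \<in> Q" "x' \<in> Q" "y' \<in> Q"
  shows "progress lt [x, y, z] [x', y', z]"
  using assms(1)
proof (elim disjE)
  assume "x \<prec> y \<and> x' \<prec> y' \<and> x \<prec> x' \<and> y \<prec> y'"
  then have "progress (\<lambda>x y. lt y x) [x, y, z] [x', y', z]"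
    using left_ordered_quandle.progress_step[OF dual] Q by blast
  then show ?thesis
    by (rule progress_dual[THEN iffD1])
qed (use progress_step Q progress_refl in auto)

context left_ordered_quandle
begin

definition steady :: "diagram \<Rightarrow> bool" where
  "steady D \<longleftrightarrow> well_formed 3 D \<and> (\<forall>f. coloring Q star D f \<longrightarrow>
     progress lt (map f (lft D)) (map f (rgt D)) \<and>
     (\<forall>x. map f (lft D) = [x, x, x] \<longrightarrow> constant_on D f x))"

text \<open>After the rotation, the endpoints at position 1 are \<open>NE\<close> on the left and \<open>SE\<close> on the right, and
  those at position 2 are \<open>NW\<close> and \<open>SW\<close>. So if the tangle is rising, the outer color is the larger one
  and both colors go down.\<close>

lemma steady_on12_rotate_tangle:
  assumes "monotone_tangle D"
  shows "steady (on12 (rotate_tangle D))"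
  unfolding steady_def
proof (intro conjI allI impI)
  let ?X = "on12 (rotate_tangle D)"
  have wf: "well_formed 2 D"
    using assms by (simp add: monotone_tangle_def)
  note ends = well_formed_tangle[OF wf]
  have "well_formed (2 + 1) ?X"
    by (rule well_formed_stack[OF well_formed_rotate_tangle[OF wf] well_formed_strand])
  then show "well_formed 3 ?X"
    by simp
  fix f assume f: "coloring Q star ?X f"
  have "coloring Q star D f"
    using coloring_stack(1)[OF f] by (simp add: coloring_def)
  then have cases: "rising lt D f \<or> rising (\<lambda>x y. lt y x) D f \<or> (\<exists>x. constant_on D f x)"
    using assms unfolding monotone_tangle_def by blast
  have Q: "f i \<in> Q" for i
    by (rule coloring_in[OF f])
  have "progress lt [f (ne D), f (nw D), f (segs D)] [f (se D), f (sw D), f (segs D)]"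
    using cases ends by (intro progress_twist Q) (auto simp: rising_def constant_on_def)
  then show "progress lt (map f (lft ?X)) (map f (rgt ?X))"
    by simp
  fix x assume x: "map f (lft ?X) = [x, x, x]"
  then have "constant_on D f x"
    using cases ends lt_irrefl Q unfolding rising_def constant_on_def by fastforce
  moreover have "constant_on strand (\<lambda>i. f (segs D + i)) x"
    using x by (simp add: constant_on_def)
  ultimately show "constant_on ?X f x"
    by (rule constant_on_append[of _ D strand, rotated]) simp_all
qed

text \<open>The outer position is now the third one, with the endpoints \<open>SW\<close> and \<open>SE\<close>, and triples are read
  from bottom to top. If the tangle is rising, the outer color is the smaller one and both colors go
  up.\<close>

lemma steady_on23:
  assumes "monotone_tangle D"
  shows "steady (on23 D)"
  unfolding steady_def
proof (intro conjI allI impI)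
  have wf: "well_formed 2 D"
    using assms by (simp add: monotone_tangle_def)
  note ends = well_formed_tangle[OF wf]
  have "well_formed (1 + 2) (on23 D)"
    by (rule well_formed_stack[OF well_formed_strand wf])
  then show "well_formed 3 (on23 D)"
    by (simp add: numeral_3_eq_3)
  fix f assume f: "coloring Q star (on23 D) f"
  let ?g = "\<lambda>i. f (segs strand + i)"
  have cases: "rising lt D ?g \<or> rising (\<lambda>x y. lt y x) D ?g \<or> (\<exists>x. constant_on D ?g x)"
    using assms coloring_stack(2)[OF f] unfolding monotone_tangle_def by blast
  have Q: "f i \<in> Q" for i
    by (rule coloring_in[OF f])
  have "progress lt [?g (sw D), ?g (nw D), f 0] [?g (se D), ?g (ne D), f 0]"
    using cases ends by (intro progress_twist Q) (auto simp: rising_def constant_on_def)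
  then have "progress lt [f 0, ?g (nw D), ?g (sw D)] [f 0, ?g (ne D), ?g (se D)]"
    by (rule progress_rev[THEN iffD1])
  moreover have lists: "map f (lft (on23 D)) = [f 0, ?g (nw D), ?g (sw D)]"
    "map f (rgt (on23 D)) = [f 0, ?g (ne D), ?g (se D)]"
    by (subst stack_simps, subst shift_simps, subst ends, simp)+
  ultimately show "progress lt (map f (lft (on23 D))) (map f (rgt (on23 D)))"
    by simp
  fix x assume x: "map f (lft (on23 D)) = [x, x, x]"
  then have "constant_on D ?g x"
    using cases ends lt_irrefl Q lists unfolding rising_def constant_on_def by fastforce
  moreover have "constant_on strand f x"
    using x by (simp add: constant_on_def)
  ultimately show "constant_on (on23 D) f x"
    by - (rule constant_on_append[of _ strand D], simp_all)
qed

lemma steady_beside: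
  assumes "steady D" "steady E"
  shows "steady (beside D E)"
  unfolding steady_def
proof (intro conjI allI impI)
  have wf: "well_formed 3 D" "well_formed 3 E"
    using assms by (simp_all add: steady_def)
  then show "well_formed 3 (beside D E)"
    by (rule well_formed_beside)
  fix f assume f: "coloring Q star (beside D E) f"
  let ?g = "\<lambda>i. f (segs D + i)"
  have glue: "map ?g (lft E) = map f (rgt D)"
    using coloring_beside_glue[OF f wf] wf by (intro nth_equalityI) (simp_all add: well_formed_def)
  have D: "progress lt (map f (lft D)) (map f (rgt D))"
    "\<And>x. map f (lft D) = [x, x, x] \<Longrightarrow> constant_on D f x"
    using assms(1) coloring_beside(1)[OF f] unfolding steady_def by auto
  have E: "progress lt (map ?g (lft E)) (map ?g (rgt E))"
    "\<And>x. map ?g (lft E) = [x, x, x] \<Longrightarrow> constant_on E ?g x"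
    using assms(2) coloring_beside(2)[OF f] unfolding steady_def by auto
  have "map f (rgt (beside D E)) = map ?g (rgt E)"
    by simp
  then show "progress lt (map f (lft (beside D E))) (map f (rgt (beside D E)))"
    using progress_trans[OF D(1)] E(1) glue by (simp add: o_def)
  fix x assume "map f (lft (beside D E)) = [x, x, x]"
  then have D': "constant_on D f x"
    using D(2) by simp
  have "constant_on E ?g x"
    using E(2) glue constant_on_ends(2)[OF wf(1) D'] by simp
  then show "constant_on (beside D E) f x"
    by (rule constant_on_append[OF beside_simps(1) D'])
qed

lemma steady_concat_diagrams: "(\<And>D. D \<in> set Ds \<Longrightarrow> steady D) \<Longrightarrow> steady (concat_diagrams Ds)"
proof (induction Ds)
  case Nil
  have "well_formed (1 + (1 + 1)) (stack strand (stack strand strand))"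
    by (intro well_formed_stack well_formed_strand)
  then have "well_formed 3 (stack strand (stack strand strand))"
    by (simp add: numeral_3_eq_3)
  then show ?case
    by (auto simp: concat_diagrams_def steady_def progress_refl constant_on_def less_Suc_eq)
next
  case (Cons D Ds)
  then show ?case
    using steady_beside by (simp add: concat_diagrams_def)
qed

end


section \<open>The full twist on color triples\<close>

text \<open>Each of the three factors \<open>h\<close> takes the strand on top to the bottom, under the two others. The
  second and the third strand pass under strands that have changed their color before, whence the
  colors \<open>w ! 0\<close> and \<open>w ! 1\<close> on the right-hand sides.\<close>

definition full_twist :: "('a \<Rightarrow> 'a \<Rightarrow> 'a) \<Rightarrow> 'a list \<Rightarrow> 'a list \<Rightarrow> bool" where
  "full_twist star v w \<longleftrightarrow> w ! 0 = star (star (v ! 0) (v ! 1)) (v ! 2) \<and>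
     w ! 1 = star (star (v ! 1) (v ! 2)) (w ! 0) \<and>
     w ! 2 = star (star (v ! 2) (w ! 0)) (w ! 1)"

context left_ordered_quandle
begin

lemma star_star: "\<lbrakk>x \<in> Q; y \<in> Q; z \<in> Q\<rbrakk> \<Longrightarrow> x \<star> (y \<star> z) = ((x \<star> z) \<star> y) \<star> z"
  using right_dist[of "x \<star> z" y z] by (simp add: closed invol)

text \<open>The full twist acts on its three input colors by one and the same product of right
  multiplications, hence by an automorphism. In this form the inverse is visible.\<close>

lemma full_twist_conj:
  assumes Q: "a \<in> Q" "b \<in> Q" "c \<in> Q" and twist: "full_twist star [a, b, c] [a', b', c']"
  shows "a' = ((a \<star> a) \<star> b) \<star> c" "b' = ((b \<star> a) \<star> b) \<star> c" "c' = ((c \<star> a) \<star> b) \<star> c"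
proof -
  have a': "a' = (a \<star> b) \<star> c" and b': "b' = (b \<star> c) \<star> a'" and c': "c' = (c \<star> a') \<star> b'"
    using twist by (simp_all add: full_twist_def)
  note [simp] = closed Q idem
  show "a' = ((a \<star> a) \<star> b) \<star> c"
    by (simp add: a')
  have "b' = (b \<star> (a \<star> b)) \<star> c"
    using right_dist[of b "a \<star> b" c] by (simp add: b' a')
  then show "b' = ((b \<star> a) \<star> b) \<star> c"
    by (simp add: star_star)
  have "c' = (c \<star> (b \<star> c)) \<star> a'"
    using right_dist[of c "b \<star> c" a'] by (simp add: c' b' a')
  also have "\<dots> = ((c \<star> b) \<star> c) \<star> a'"
    by (simp add: star_star)
  also have "\<dots> = ((c \<star> b) \<star> (a \<star> b)) \<star> c"
    using right_dist[of "c \<star> b" "a \<star> b" c] by (simp add: a')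
  also have "\<dots> = ((c \<star> a) \<star> b) \<star> c"
    using right_dist[of "c" "a" b] by simp
  finally show "c' = ((c \<star> a) \<star> b) \<star> c" .
qed

lemma full_twist_hom:
  assumes "a \<in> Q" "b \<in> Q" "c \<in> Q" "y \<in> Q" "full_twist star [a, b, c] [a', b', c']"
  shows "full_twist star [a \<star> y, b \<star> y, c \<star> y] [a' \<star> y, b' \<star> y, c' \<star> y]"
proof -
  have dist: "(u \<star> v) \<star> y = (u \<star> y) \<star> (v \<star> y)" if "u \<in> Q" "v \<in> Q" for u v
    using right_dist that assms(4) by blast
  have twist: "a' = (a \<star> b) \<star> c" "b' = (b \<star> c) \<star> a'" "c' = (c \<star> a') \<star> b'"
    using assms(5) by (simp_all add: full_twist_def)
  have Q': "a' \<in> Q" "b' \<in> Q" "c' \<in> Q"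
    using twist closed assms(1-3) by simp_all
  have "a' \<star> y = ((a \<star> y) \<star> (b \<star> y)) \<star> (c \<star> y)"
    using dist[of "a \<star> b" c] dist[of a b] twist(1) assms(1-3) closed by simp
  moreover have "b' \<star> y = ((b \<star> y) \<star> (c \<star> y)) \<star> (a' \<star> y)"
    using dist[of "b \<star> c" a'] dist[of b c] twist(2) assms(1-3) Q' closed by simp
  moreover have "c' \<star> y = ((c \<star> y) \<star> (a' \<star> y)) \<star> (b' \<star> y)"
    using dist[of "c \<star> a'" b'] dist[of c a'] twist(3) assms(1-3) Q' closed by simp
  ultimately show ?thesis
    unfolding full_twist_def by simp
qed

text \<open>For a valley, \<open>a \<star> b\<close> is at most \<open>b\<close> and \<open>b\<close> at most \<open>c\<close>, not both with equality, which puts \<open>a' = (a \<star> b) \<star> c\<close> above \<open>c\<close> and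
  \<open>c \<star> a'\<close> even higher. If the middle color \<open>b'\<close> is at most \<open>a'\<close>, it therefore passes over a strand whose
  color is higher, and that strand emerges below it with the color \<open>c'\<close>.\<close>

lemma full_twist_valley:
  assumes Q: "a \<in> Q" "b \<in> Q" "c \<in> Q" and twist: "full_twist star [a, b, c] [a', b', c']"
    and valley: "valley lt [a, b, c]"
  shows "\<not> valley lt [a', b', c']"
proof
  assume valley': "valley lt [a', b', c']"
  have a': "a' = (a \<star> b) \<star> c" and b': "b' = (b \<star> c) \<star> a'" and c': "c' = (c \<star> a') \<star> b'"
    using twist by (simp_all add: full_twist_def)
  have Q': "a' \<in> Q" "b' \<in> Q" "c' \<in> Q"
    by (simp_all add: a' b' c' closed Q)
  have "\<not> a \<prec> b" "\<not> c \<prec> b" "\<not> (a = b \<and> b = c)"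
    using valley by (simp_all add: valley_def)
  then have "a \<star> b \<prec> c"
    using lt_total[of a b] lt_total[of b c] over_between'[of a b] lt_trans[of "a \<star> b" b c] idem Q closed
    by auto
  then have "c \<prec> a'"
    unfolding a' using over_between Q closed by blast
  then have "a' \<prec> c \<star> a'"
    using over_between Q Q' by blast
  moreover have "b' = a' \<or> b' \<prec> a'"
    using valley' lt_total[of a' b'] Q' by (auto simp: valley_def)
  ultimately have "b' \<prec> c \<star> a'"
    using lt_trans[of b' a' "c \<star> a'"] Q Q' closed by blast
  then have "c' \<prec> b'"
    unfolding c' using over_between' Q Q' closed by blast
  then show False
    using valley' by (simp add: valley_def)
qed

lemma full_twist_peak:
  assumes "a \<in> Q" "b \<in> Q" "c \<in> Q" "full_twist star [a, b, c] [a', b', c']" "peak lt [a, b, c]"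
  shows "\<not> peak lt [a', b', c']"
  using left_ordered_quandle.full_twist_valley[OF dual] assms by blast

text \<open>Both \<open>c' \<prec> c\<close> and \<open>c \<prec> c'\<close> follow: the first since \<open>c = (c' \<star> b') \<star> a'\<close> is compared with
  \<open>c' = (c' \<star> b') \<star> b'\<close> by left multiplication, the second since \<open>(c \<star> a) \<star> b\<close> is compared with
  \<open>c = (c \<star> a) \<star> a\<close> and then passes under \<open>c\<close>.\<close>

lemma full_twist_descending:
  assumes Q: "a \<in> Q" "b \<in> Q" "c \<in> Q" and twist: "full_twist star [a, b, c] [a', b', c']"
    and desc: "descending lt [a, b, c]"
  shows "\<not> descending lt [a', b', c']"
proof
  assume desc': "descending lt [a', b', c']"
  have a': "a' = (a \<star> b) \<star> c" and b': "b' = (b \<star> c) \<star> a'" and c': "c' = (c \<star> a') \<star> b'"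
    using twist by (simp_all add: full_twist_def)
  have Q': "a' \<in> Q" "b' \<in> Q" "c' \<in> Q"
    by (simp_all add: a' b' c' closed Q)
  have "b \<prec> a" "b' \<prec> a'"
    using desc desc' by (simp_all add: descending_def)
  then have "(c' \<star> b') \<star> b' \<prec> (c' \<star> b') \<star> a'" "(c \<star> a) \<star> b \<prec> (c \<star> a) \<star> a"
    using star_mono Q Q' closed by blast+
  moreover have "(c' \<star> b') \<star> a' = c"
    by (simp add: c' invol closed Q Q')
  ultimately have "c' \<prec> c" "(c \<star> a) \<star> b \<prec> c"
    by (simp_all add: invol closed Q Q')
  then have "c \<prec> c'"
    unfolding full_twist_conj(3)[OF Q twist] using over_between closed Q by blast
  then show False
    using \<open>c' \<prec> c\<close> lt_asym Q Q' by blast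
qed

lemma full_twist_ascending:
  assumes "a \<in> Q" "b \<in> Q" "c \<in> Q" "full_twist star [a, b, c] [a', b', c']" "ascending lt [a, b, c]"
  shows "\<not> ascending lt [a', b', c']"
  using left_ordered_quandle.full_twist_descending[OF dual] assms by blast

text \<open>The map \<open>\<psi>\<close> in the proof is the inverse of the action of the full twist. The first hypothesis on
  shapes concerns one period of the coloring, the second one the next period, which is the image of
  the first under \<open>\<psi>\<close>. Applied to the second, \<open>full_twist_valley\<close> excludes a valley; applied to the
  first, \<open>full_twist_descending\<close> excludes a descending triple.\<close>

lemma full_twist_progress_constant:
  assumes Q: "a \<in> Q" "b \<in> Q" "c \<in> Q" and twist: "full_twist star [a, b, c] [a', b', c']"
    and prog: "progress lt [a', b', c'] [a, b, c]"
    and prog': "progress lt [a, b, c]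
      [((a \<star> c) \<star> b) \<star> a, ((b \<star> c) \<star> b) \<star> a, ((c \<star> c) \<star> b) \<star> a]"
  shows "a = b \<and> b = c"
proof (rule ccontr)
  assume neq: "\<not> (a = b \<and> b = c)"
  define \<psi> where "\<psi> x = ((x \<star> c) \<star> b) \<star> a" for x
  note conj = full_twist_conj[OF Q twist]
  have Q': "a' \<in> Q" "b' \<in> Q" "c' \<in> Q"
    by (simp_all add: conj closed Q)
  have Q\<psi>: "\<psi> a \<in> Q" "\<psi> b \<in> Q" "\<psi> c \<in> Q"
    by (simp_all add: \<psi>_def closed Q)
  have "\<psi> a' = a" "\<psi> b' = b" "\<psi> c' = c"
    by (simp_all add: \<psi>_def conj closed Q invol idem)
  moreover have "full_twist star [\<psi> a, \<psi> b, \<psi> c] [\<psi> a', \<psi> b', \<psi> c']"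
    unfolding \<psi>_def by (intro full_twist_hom closed Q twist)
  ultimately have twist\<psi>: "full_twist star [\<psi> a, \<psi> b, \<psi> c] [a, b, c]"
    by simp
  have no: "\<not> valley lt [a, b, c]" "\<not> peak lt [a, b, c]"
    using full_twist_valley[OF Q\<psi> twist\<psi>] full_twist_peak[OF Q\<psi> twist\<psi>] prog'
    unfolding progress_def \<psi>_def by blast+
  have state: "valley lt [x, y, z] \<or> peak lt [x, y, z] \<or> descending lt [x, y, z] \<or>
      ascending lt [x, y, z] \<or> x = y \<and> y = z" if "x \<in> Q" "y \<in> Q" "z \<in> Q" for x y z
    using that lt_total[of x y] lt_total[of y z] lt_asym[of x y] lt_asym[of y x]
      lt_asym[of z y] lt_asym[of y z] lt_irrefl[of y]
    by (auto simp: valley_def descending_def)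
  have nconst: "\<not> (a' = b' \<and> b' = c')"
    using \<open>\<psi> a' = a\<close> \<open>\<psi> b' = b\<close> \<open>\<psi> c' = c\<close> neq by auto
  have excl: "\<not> (descending lt [a, b, c] \<and> ascending lt [a, b, c])"
    using lt_asym Q by (auto simp: descending_def)
  from state[OF Q] no neq excl show False
    using state[OF Q'] nconst prog full_twist_descending[OF Q twist] full_twist_ascending[OF Q twist]
    unfolding progress_def by blast
qed

text \<open>Right multiplication by a color is an automorphism and takes a coloring to a coloring; this yields
  the second period. In the second case of \<open>twist\<close> the triples are read from bottom to top.\<close>

lemma steady_twisted_closure_constant:
  assumes "steady T" and g: "coloring Q star T g"
    and ends: "map g (lft T) = [a', b', c']" "map g (rgt T) = [a, b, c]"
    and twist: "full_twist star [a, b, c] [a', b', c'] \<or> full_twist star [c, b, a] [c', b', a']"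
  shows "a = b \<and> b = c"
proof -
  have "set (map g (rgt T)) \<subseteq> Q"
    using coloring_in[OF g] by auto
  then have Q: "a \<in> Q" "b \<in> Q" "c \<in> Q"
    by (simp_all add: ends)
  have prog: "progress lt (map f (lft T)) (map f (rgt T))" if "coloring Q star T f" for f
    using assms(1) that unfolding steady_def by blast
  have move: "coloring Q star T (\<lambda>i. f i \<star> y)" if "coloring Q star T f" "y \<in> Q" for f y
    unfolding coloring_def
  proof (intro conjI allI ballI)
    have fQ: "f i \<in> Q" for i
      by (rule coloring_in[OF that(1)])
    show "f i \<star> y \<in> Q" for i
      using closed fQ that(2) by blast
    show "case ij of (i, j) \<Rightarrow> f i \<star> y = f j \<star> y" if "ij \<in> set (joins T)" for ij
      using coloring_join[OF \<open>coloring Q star T f\<close>] that by (cases ij) auto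
    fix k assume "k \<in> set (crossings T)"
    then have "f (over1 k) = f (over2 k)" "f (under2 k) = f (under1 k) \<star> f (over1 k)"
      using that(1) unfolding coloring_def by blast+
    then show "f (over1 k) \<star> y = f (over2 k) \<star> y"
      "f (under2 k) \<star> y = (f (under1 k) \<star> y) \<star> (f (over1 k) \<star> y)"
      using right_dist[OF fQ fQ that(2)] by simp_all
  qed
  have shifted: "progress lt (map (\<lambda>x. ((x \<star> u) \<star> v) \<star> w) (map g (lft T)))
      (map (\<lambda>x. ((x \<star> u) \<star> v) \<star> w) (map g (rgt T)))" if "u \<in> Q" "v \<in> Q" "w \<in> Q" for u v w
    using prog[OF move[OF move[OF move[OF g that(1)] that(2)] that(3)]] by (simp add: o_def)
  have *: "progress lt [a', b', c'] [a, b, c]"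
    using prog[OF g] by (simp only: ends)
  from twist show ?thesis
  proof
    assume tw: "full_twist star [a, b, c] [a', b', c']"
    note conj = full_twist_conj[OF Q tw]
    show ?thesis
      using full_twist_progress_constant[OF Q tw *] shifted[OF Q(3,2,1)]
      by (simp add: ends conj closed Q invol idem)
  next
    assume tw: "full_twist star [c, b, a] [c', b', a']"
    note conj = full_twist_conj[OF Q(3,2,1) tw]
    have "progress lt [a, b, c]
        [((a \<star> a) \<star> b) \<star> c, ((b \<star> a) \<star> b) \<star> c, ((c \<star> a) \<star> b) \<star> c]"
      using shifted[OF Q] by (simp add: ends conj closed Q invol idem)
    then have "c = b \<and> b = a"
      using * by (intro full_twist_progress_constant[OF Q(3,2,1) tw]) (simp_all only: progress_rev)
    then show ?thesis
      by simp
  qed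
qed

end


section \<open>Colorings of the link\<close>

context left_ordered_quandle
begin

text \<open>\<open>E\<close> is a right part of \<open>D\<close>, colored by \<open>g\<close>, that determines whether the coloring \<open>f\<close> of \<open>D\<close> is
  constant.\<close>

definition continues :: "diagram \<Rightarrow> (nat \<Rightarrow> 'a) \<Rightarrow> diagram \<Rightarrow> (nat \<Rightarrow> 'a) \<Rightarrow> bool" where
  "continues D f E g \<longleftrightarrow> coloring Q star E g \<and> map g (rgt E) = map f (rgt D) \<and>
     (\<forall>x. constant_on E g x \<longrightarrow> constant_on D f x)"

lemma continues_trans: "continues D f E g \<Longrightarrow> continues E g F h \<Longrightarrow> continues D f F h"
  unfolding continues_def by simp

text \<open>A braid generator transforms the triple of colors by a function. That function is invertible,
  so a constant triple on the right comes from a constant coloring.\<close>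

definition relays :: "diagram \<Rightarrow> ('a list \<Rightarrow> 'a list) \<Rightarrow> bool" where
  "relays X r \<longleftrightarrow> well_formed 3 X \<and> (\<forall>f. coloring Q star X f \<longrightarrow>
     map f (rgt X) = r (map f (lft X)) \<and> (\<forall>x. map f (rgt X) = [x, x, x] \<longrightarrow> constant_on X f x))"

lemma well_formed_on_crossing:
  assumes "C = pos_crossing \<or> C = neg_crossing"
  shows "well_formed 3 (on12 C)" "well_formed 3 (on23 C)"
proof -
  have C: "well_formed 2 C"
    using assms well_formed_crossing by auto
  show "well_formed 3 (on12 C)" "well_formed 3 (on23 C)"
    using well_formed_stack[OF C well_formed_strand] well_formed_stack[OF well_formed_strand C]
    by (simp_all add: numeral_3_eq_3)
qed

lemma relays_crossings:
  "relays (on12 pos_crossing) (\<lambda>v. [v ! 1, v ! 0 \<star> v ! 1, v ! 2])"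
  "relays (on23 pos_crossing) (\<lambda>v. [v ! 0, v ! 2, v ! 1 \<star> v ! 2])"
  "relays (on12 neg_crossing) (\<lambda>v. [v ! 1 \<star> v ! 0, v ! 0, v ! 2])"
  "relays (on23 neg_crossing) (\<lambda>v. [v ! 0, v ! 2 \<star> v ! 1, v ! 1])"
proof -
  \<comment> \<open>If the two strands leave a crossing with one color, they also entered it with that color.\<close>
  have eq: "x = y" if "x \<in> Q" "y \<in> Q" "x \<star> y = y" for x y
    using invol[OF that(1,2)] idem[OF that(2)] that(3) by simp
  show "relays (on12 pos_crossing) (\<lambda>v. [v ! 1, v ! 0 \<star> v ! 1, v ! 2])"
    "relays (on23 pos_crossing) (\<lambda>v. [v ! 0, v ! 2, v ! 1 \<star> v ! 2])"
    "relays (on12 neg_crossing) (\<lambda>v. [v ! 1 \<star> v ! 0, v ! 0, v ! 2])"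
    "relays (on23 neg_crossing) (\<lambda>v. [v ! 0, v ! 2 \<star> v ! 1, v ! 1])"
    unfolding relays_def using well_formed_on_crossing
    by (simp_all add: pos_crossing_def neg_crossing_def coloring_def
        constant_on_def less_Suc_eq numeral_eq_Suc) (auto intro: eq)
qed

lemma well_formed_foldr_beside:
  "list_all2 relays Xs rs \<Longrightarrow> well_formed 3 E \<Longrightarrow> well_formed 3 (foldr beside Xs E)"
  by (induction rule: list_all2_induct) (auto simp: relays_def intro: well_formed_beside)

lemma continues_foldr_beside:
  assumes "list_all2 relays Xs rs" "well_formed 3 E" "coloring Q star (foldr beside Xs E) f"
  shows "\<exists>g. continues (foldr beside Xs E) f E g \<and>
    map g (lft E) = fold (\<lambda>r v. r v) rs (map f (lft (foldr beside Xs E)))"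
  using assms(1,3)
proof (induction Xs rs arbitrary: f rule: list_all2_induct)
  case Nil
  then show ?case
    by (intro exI[of _ f]) (simp add: continues_def)
next
  case (Cons X Xs r rs)
  let ?Y = "foldr beside Xs E" and ?g = "\<lambda>i. f (segs X + i)"
  have f: "coloring Q star (beside X ?Y) f"
    using Cons.prems by simp
  have Y: "well_formed 3 ?Y"
    by (rule well_formed_foldr_beside[OF \<open>list_all2 relays Xs rs\<close> assms(2)])
  have X: "well_formed 3 X" "map f (rgt X) = r (map f (lft X))"
    "\<And>x. map f (rgt X) = [x, x, x] \<Longrightarrow> constant_on X f x"
    using \<open>relays X r\<close> coloring_beside(1)[OF f] unfolding relays_def by auto
  have glue: "map ?g (lft ?Y) = map f (rgt X)"
    using coloring_beside_glue[OF f X(1) Y] X(1) Y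
    by (intro nth_equalityI) (simp_all add: well_formed_def)
  have "constant_on (beside X ?Y) f x" if x: "constant_on ?Y ?g x" for x
  proof -
    have "constant_on X f x"
      using X(3) glue constant_on_ends(1)[OF Y x] by simp
    then show ?thesis
      by (rule constant_on_append[OF beside_simps(1) _ x])
  qed
  then have "continues (beside X ?Y) f ?Y ?g"
    using coloring_beside(2)[OF f] unfolding continues_def by (simp add: o_def)
  moreover obtain h where "continues ?Y ?g E h"
    "map h (lft E) = fold (\<lambda>r v. r v) rs (map ?g (lft ?Y))"
    using Cons.IH[OF coloring_beside(2)[OF f]] by blast
  ultimately show ?case
    using continues_trans glue X(2) by (intro exI[of _ h]) auto
qed

definition tangle_part :: "(int list \<times> int list) list \<Rightarrow> diagram" where
  "tangle_part ts = concat_diagrams (concat (map (\<lambda>(t, s).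
     [on12 (rotate_tangle (standard_diagram t)), on23 (standard_diagram s)]) ts))"

definition open_link :: "(int list \<times> int list) list \<Rightarrow> int \<Rightarrow> diagram" where
  "open_link ts l = foldr beside (h_word l) (tangle_part ts)"

lemma link_diagram_open_link: "link_diagram ts l = braid_closure (open_link ts l)"
  by (simp add: link_diagram_def open_link_def tangle_part_def concat_diagrams_def)

text \<open>The functions on triples that belong to the crossings in \<open>h_word\<close>.\<close>

definition h_actions :: "int \<Rightarrow> ('a list \<Rightarrow> 'a list) list" where
  "h_actions l = concat (replicate (nat \<bar>l\<bar>) (if l \<ge> 0
     then [\<lambda>v. [v ! 1, v ! 0 \<star> v ! 1, v ! 2], \<lambda>v. [v ! 0, v ! 2, v ! 1 \<star> v ! 2]]
     else [\<lambda>v. [v ! 0, v ! 2 \<star> v ! 1, v ! 1], \<lambda>v. [v ! 1 \<star> v ! 0, v ! 0, v ! 2]]))"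

lemma relays_h_word: "list_all2 relays (h_word l) (h_actions l)"
proof -
  have "list_all2 relays (concat (replicate n Xs)) (concat (replicate n rs))"
    if "list_all2 relays Xs rs" for n Xs rs
    by (induction n) (auto intro: list_all2_appendI that)
  then show ?thesis
    using relays_crossings unfolding h_word_def h_actions_def by simp
qed

lemma steady_tangle_part:
  assumes "\<And>t s. (t, s) \<in> set ts \<Longrightarrow> type2 t \<and> type2 s"
  shows "steady (tangle_part ts)"
  unfolding tangle_part_def
proof (rule steady_concat_diagrams)
  fix D
  assume "D \<in> set (concat (map (\<lambda>(t, s).
    [on12 (rotate_tangle (standard_diagram t)), on23 (standard_diagram s)]) ts))"
  then obtain t s where "(t, s) \<in> set ts"
    "D = on12 (rotate_tangle (standard_diagram t)) \<or> D = on23 (standard_diagram s)"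
    by auto
  then show "steady D"
    using assms[of t s] monotone_tangle_standard_diagram steady_on12_rotate_tangle steady_on23
    by blast
qed

lemma well_formed_open_link:
  assumes "\<And>t s. (t, s) \<in> set ts \<Longrightarrow> type2 t \<and> type2 s"
  shows "well_formed 3 (open_link ts l)"
proof -
  have "well_formed 3 (tangle_part ts)"
    using steady_tangle_part[OF assms] by (simp add: steady_def)
  then show ?thesis
    unfolding open_link_def by (rule well_formed_foldr_beside[OF relays_h_word])
qed

lemma well_formed_link_diagram:
  assumes "\<And>t s. (t, s) \<in> set ts \<Longrightarrow> type2 t \<and> type2 s"
  shows "well_formed 0 (link_diagram ts l)" "0 < segs (link_diagram ts l)"
proof -
  note wf = well_formed_open_link[OF assms]
  show "well_formed 0 (link_diagram ts l)"
    unfolding link_diagram_open_link by (rule well_formed_braid_closure[OF wf])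
  have "lft (open_link ts l) ! 0 < segs (open_link ts l)"
    using wf nth_mem[of 0 "lft (open_link ts l)"] unfolding well_formed_def
    by (metis lessThan_iff subsetD zero_less_numeral)
  then show "0 < segs (link_diagram ts l)"
    by (simp add: link_diagram_open_link braid_closure_def)
qed

lemma coloring_link_diagram_constant:
  assumes ts: "\<And>t s. (t, s) \<in> set ts \<Longrightarrow> type2 t \<and> type2 s" and l: "l = 3 \<or> l = -3"
    and f: "coloring Q star (link_diagram ts l) f"
  shows "\<exists>x. constant_on (link_diagram ts l) f x"
proof -
  let ?B = "open_link ts l" and ?T = "tangle_part ts"
  have T: "steady ?T" and wfB: "well_formed 3 ?B"
    using steady_tangle_part[OF ts] well_formed_open_link[OF ts] by blast+
  then have wfT: "well_formed 3 ?T"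
    by (simp add: steady_def)
  have fB: "coloring Q star ?B f"
    using f unfolding link_diagram_open_link by (auto simp: coloring_def braid_closure_def)
  obtain g where g: "continues ?B f ?T g"
      "map g (lft ?T) = fold (\<lambda>r v. r v) (h_actions l) (map f (lft ?B))"
    using continues_foldr_beside[OF relays_h_word wfT fB[unfolded open_link_def]]
    unfolding open_link_def by blast
  have closed_up: "map f (lft ?B) = map f (rgt ?B)"
  proof (rule nth_equalityI)
    fix k assume k: "k < length (map f (lft ?B))"
    then have "(lft ?B ! k, rgt ?B ! k) \<in> set (zip (lft ?B) (rgt ?B))"
      using wfB by (auto simp: well_formed_def set_zip)
    then have "(lft ?B ! k, rgt ?B ! k) \<in> set (joins (braid_closure ?B))"
      by (simp add: braid_closure_def)
    then show "map f (lft ?B) ! k = map f (rgt ?B) ! k"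
      using coloring_join[OF f[unfolded link_diagram_open_link]] k wfB by (simp add: well_formed_def)
  qed (use wfB in \<open>simp add: well_formed_def\<close>)
  have three: "\<exists>a b c. map u xs = [a, b, c]" if xs: "length xs = 3" for u :: "nat \<Rightarrow> 'a" and xs
  proof -
    obtain i j k where "xs = [i, j, k]"
      using xs by (auto simp: numeral_3_eq_3 length_Suc_conv)
    then show ?thesis
      by simp
  qed
  obtain a b c where abc: "map f (lft ?B) = [a, b, c]"
    using three[of "lft ?B" f] wfB by (auto simp: well_formed_def)
  have gT: "coloring Q star ?T g"
    using g(1) by (simp add: continues_def)
  have rgtT: "map g (rgt ?T) = [a, b, c]"
    using g(1) abc closed_up by (simp add: continues_def)
  obtain a' b' c' where lftT: "map g (lft ?T) = [a', b', c']"
    using three[of "lft ?T" g] wfT by (auto simp: well_formed_def)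
  \<comment> \<open>The inverse of \<open>h\<close>, read from bottom to top, consists of the same steps as \<open>h\<close>.\<close>
  have twist: "full_twist star [a, b, c] [a', b', c'] \<or> full_twist star [c, b, a] [c', b', a']"
    using l g(2) unfolding lftT abc by (auto simp: full_twist_def h_actions_def numeral_3_eq_3)
  then have eq: "a = b" "b = c"
    using steady_twisted_closure_constant[OF T gT lftT rgtT] by auto
  have "a \<in> set (map f (lft ?B))"
    by (simp add: abc)
  then have "a \<in> Q"
    using coloring_in[OF fB] by auto
  then have "map g (lft ?T) = [a, a, a]"
    using twist idem unfolding lftT eq[symmetric] by (auto simp: full_twist_def)
  then have "constant_on ?T g a"
    using T gT unfolding steady_def by auto
  then have "constant_on ?B f a"
    using g(1) by (simp add: continues_def)
  then show ?thesis
    unfolding link_diagram_open_link by (auto simp: constant_on_def braid_closure_def)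
qed

end


section \<open>From colorings to the involutory quandle\<close>

text \<open>The tautological coloring by the generators. The numbers that are not segments
  get the class of segment 0, to stay inside the quandle.\<close>

definition arc_class :: "diagram \<Rightarrow> nat \<Rightarrow> nat set qterm set" where
  "arc_class D i = iq_rel (arcs D) (crossing_relations D) ``
     {Gen (arc_of D (if i < segs D then i else 0))}"

lemma coloring_arc_class:
  assumes wf: "well_formed n D" and "0 < segs D"
  shows "coloring (IQ D) (IQ_star D) D (arc_class D)"
proof -
  have arc: "arc_of D i \<in> arcs D" if "i < segs D" for i
    using that by (simp add: arcs_def)
  have connected: "arc_of D i = arc_of D j" if "(i, j) \<in> connections D" for i j
  proof -
    let ?r = "connections D \<union> (connections D)\<inverse>"
    have "(i, j) \<in> ?r\<^sup>*" "(j, i) \<in> ?r\<^sup>*"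
      using that by auto
    then show ?thesis
      unfolding arc_of_def by (auto intro: rtrancl_trans)
  qed
  show ?thesis
    unfolding coloring_def
  proof (intro conjI allI ballI)
    show "arc_class D i \<in> IQ D" for i
      using assms(2) arc unfolding IQ_def arc_class_def by (intro iq_carrierI) simp
    show "case ij of (i, j) \<Rightarrow> arc_class D i = arc_class D j" if ij: "ij \<in> set (joins D)" for ij
    proof -
      obtain i j where [simp]: "ij = (i, j)"
        by fastforce
      have "ij \<in> {..<segs D} \<times> {..<segs D}"
        using wf ij unfolding well_formed_def by blast
      then show ?thesis
        using connected[of i j] ij by (simp add: arc_class_def connections_def)
    qed
    fix k assume k: "k \<in> set (crossings D)"
    then have bounds: "over1 k < segs D" "over2 k < segs D" "under1 k < segs D" "under2 k < segs D"
      using wf crossing.set_sel unfolding well_formed_def by fastforce+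
    show "arc_class D (over1 k) = arc_class D (over2 k)"
      using connected[of "over1 k" "over2 k"] k bounds by (simp add: arc_class_def connections_def)
    have "iq_eq (arcs D) (crossing_relations D) (Gen (arc_of D (under2 k)))
        (Op (Gen (arc_of D (under1 k))) (Gen (arc_of D (over1 k))))"
      using k bounds arc by (intro iq_eq.rel) (auto simp: crossing_relations_def)
    then show "arc_class D (under2 k) = IQ_star D (arc_class D (under1 k)) (arc_class D (over1 k))"
      using bounds arc by (simp add: arc_class_def IQ_star_def iq_star_class iq_class_eq)
  qed
qed

lemma constant_arc_class_trivial_quandle:
  assumes "constant_on D (arc_class D) x"
  shows "trivial_quandle (IQ D) (IQ_star D)"
proof -
  let ?r = "iq_rel (arcs D) (crossing_relations D)"
  have x: "?r `` {t} = x" if "t \<in> qterms (arcs D)" for t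
    using that
  proof (induction t)
    case (Gen g)
    then obtain i where "i < segs D" "g = arc_of D i"
      by (auto simp: arcs_def)
    then show ?case
      using assms by (auto simp: constant_on_def arc_class_def)
  next
    case (Op s t)
    then have st: "s \<in> qterms (arcs D)" "?r `` {s} = x" "?r `` {t} = x"
      by auto
    have "?r `` {Op s t} = iq_star (arcs D) (crossing_relations D) (?r `` {s}) (?r `` {s})"
      using iq_star_class[of s "arcs D" t "crossing_relations D"] Op.prems st by simp
    also have "\<dots> = ?r `` {s}"
      using iq_star_class[of s "arcs D" s] iq_class_eq[OF iq_eq.idem[OF st(1)]] st(1) by simp
    finally show ?case
      using st by simp
  qed
  have single: "X = x" if "X \<in> IQ D" for X
    using that x unfolding IQ_def by (elim iq_carrierE) simp
  then show ?thesis
    using involutory_quandle_iq[of "arcs D" "crossing_relations D"]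
    unfolding trivial_quandle_def IQ_def IQ_star_def involutory_quandle_def quandle_def by metis
qed

text \<open>The argument is the same for both signs of the twist: a left-order on the quandle would make the
  tautological coloring constant.\<close>

theorem theorem4p3:
  fixes ts :: "(int list \<times> int list) list" and l :: int
  assumes "ts \<noteq> []"
    and "\<And>t s. (t, s) \<in> set ts \<Longrightarrow> type2 t \<and> type2 s"
  shows "(l = 3 \<and> \<bar>fraction (snd (last ts))\<bar> \<ge> 1 \<longrightarrow>
           \<not> left_orderable (IQ (link_diagram ts l)) (IQ_star (link_diagram ts l))) \<and>
         (l = -3 \<and> \<bar>fraction (fst (hd ts))\<bar> \<le> 1 \<longrightarrow>
           \<not> left_orderable (IQ (link_diagram ts l)) (IQ_star (link_diagram ts l)))"
proof -
  let ?D = "link_diagram ts l"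
  have "\<not> left_orderable (IQ ?D) (IQ_star ?D)" if l: "l = 3 \<or> l = -3"
  proof
    assume "left_orderable (IQ ?D) (IQ_star ?D)"
    then obtain lt where nontrivial: "\<not> trivial_quandle (IQ ?D) (IQ_star ?D)"
      and lt: "left_order (IQ ?D) (IQ_star ?D) lt"
      unfolding left_orderable_def by blast
    have "left_ordered_quandle (IQ ?D) (IQ_star ?D) lt"
      unfolding left_ordered_quandle_def left_ordered_quandle_axioms_def
      using lt involutory_quandle_iq unfolding IQ_def IQ_star_def by blast
    then interpret left_ordered_quandle "IQ ?D" "IQ_star ?D" lt .
    obtain x where "constant_on ?D (arc_class ?D) x"
      using coloring_link_diagram_constant[OF assms(2) l]
        coloring_arc_class[OF well_formed_link_diagram[OF assms(2)]] by blast
    then show False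
      using constant_arc_class_trivial_quandle nontrivial by blast
  qed
  then show ?thesis
    by blast
qed

end
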